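(* Let $\Lambda\in\wedge^*_{\mathbb{Q}}\cap\mathcal{C}_{\mathrm{hol}}$. The moment polyhedron $\Delta_{S(U(2)\times U(2))}(SU(2,2)\cdot\Lambda)$ is the set of $\xi=(\xi_1,\xi_2,\xi_3,\xi_4)\in\mathfrak{t}^*$ defined by $$\begin{aligned}&\xi_1\ge\Lambda_1,\quad\xi_2\ge\Lambda_2,\quad\Lambda_3\ge\xi_3,\quad\Lambda_4\ge\xi_4,\\ &|\xi_1-\xi_2-\xi_3+\xi_4|\le\Lambda_1-\Lambda_2+\Lambda_3-\Lambda_4,\\ &-\xi_1+\xi_2-\xi_3+\xi_4\le-|\Lambda_1-\Lambda_2-\Lambda_3+\Lambda_4|,\\ &\xi_1\ge\xi_2,\quad\xi_3\ge\xi_4.\end{aligned}$$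
   Context: $G=SU(2,2)=\{M\in SL_4(\mathbb{C}):{}^t\overline{M}I_{2,2}M=I_{2,2}\}$, $I_{2,2}=\mathrm{diag}(1,1,-1,-1)$; $K=S(U(2)\times U(2))$ is the block-diagonal maximal compact subgroup, $T$ its torus of diagonal matrices, $\mathfrak{t}=\{\mathrm{diag}(ih_1,\dots,ih_4):\sum h_j=0\}$. Elements of $\mathfrak{t}^*$ are written uniquely as $\xi=\sum_j\xi_je_j^*$ with $\sum_j\xi_j=0$, where $e_j^*(\mathrm{diag}(ih_1,\dots,ih_4))=h_j$. $\wedge^*\subset\mathfrak{t}^*$ is the lattice of $\alpha$ such that $i\alpha$ is the differential of a character of $T$, and $\wedge^*_{\mathbb{Q}}=\wedge^*\otimes\mathbb{Q}$ (the elements with rational coordinates). $\mathfrak{t}_+^*=\{\xi_1\ge\xi_2,\ \xi_3\ge\xi_4\}$. The positive noncompact roots are $e_i^*-e_{2+j}^*$, $i,j\in\{1,2\}$, and $\mathcal{C}_{\mathrm{hol}}$ is the set of $\xi\in\mathfrak{t}_+^*$ having strictly positive inner product (for the Killing form) with all of them, i.e. $\xi_1\ge\xi_2>\xi_3\ge\xi_4$. $SU(2,2)\cdot\Lambda\subset\mathfrak{g}^*$ is the coadjoint orbit ($\mathfrak{t}^*\subset\mathfrak{k}^*\subset\mathfrak{g}^*$ via the Killing form) and $\Delta_K(SU(2,2)\cdot\Lambda)$ is the intersection with $\mathfrak{t}_+^*$ of its image under the restriction map $\mathfrak{g}^*\to\mathfrak{k}^*$. *)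

theory Defs
  imports "HOL-Analysis.Analysis"
begin

text \<open>
  Matrices and vectors are indexed by the type \<open>4\<close>, whose elements are \<open>1, 2, 3, 4\<close>
  (with \<open>4 = 0\<close>). The two diagonal blocks are the index sets \<open>{1, 2}\<close> and \<open>{3, 4}\<close>.
\<close>

type_synonym mat4 = "complex ^ 4 ^ 4"

definition conj_transpose :: "mat4 \<Rightarrow> mat4" where
  "conj_transpose M = (\<chi> i j. cnj (M $ j $ i))"

definition I22 :: mat4 where
  "I22 = (\<chi> i j. if i = j then (if i \<in> {1, 2} then 1 else - 1) else 0)"

definition block_diagonal :: "mat4 \<Rightarrow> bool" where
  "block_diagonal M \<longleftrightarrow> (\<forall>i\<in>{1, 2}. \<forall>j\<in>{3, 4}. M $ i $ j = 0 \<and> M $ j $ i = 0)"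

definition diagonal :: "mat4 \<Rightarrow> bool" where
  "diagonal M \<longleftrightarrow> (\<forall>i j. i \<noteq> j \<longrightarrow> M $ i $ j = 0)"


subsection \<open>The groups \<open>G \<supseteq> K \<supseteq> T\<close> and their Lie algebras\<close>

definition SU22 :: "mat4 set" where
  "SU22 = {M. conj_transpose M ** I22 ** M = I22 \<and> det M = 1}"

definition K22 :: "mat4 set" where
  "K22 = {M \<in> SU22. block_diagonal M}"

definition T22 :: "mat4 set" where
  "T22 = {M \<in> K22. diagonal M}"

definition lie_g :: "mat4 set" where
  "lie_g = {X. conj_transpose X ** I22 + I22 ** X = 0 \<and> trace X = 0}"

definition lie_k :: "mat4 set" where
  "lie_k = {X \<in> lie_g. block_diagonal X}"

definition diag_i :: "real ^ 4 \<Rightarrow> mat4" where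
  "diag_i h = (\<chi> i j. if i = j then \<i> * complex_of_real (h $ i) else 0)"

definition lie_t :: "mat4 set" where
  "lie_t = {diag_i h | h. (\<Sum>j\<in>UNIV. h $ j) = 0}"


subsection \<open>The Killing form of \<open>\<gg>\<close>\<close>

text \<open>
  The trace of a real-linear endomorphism of a subspace \<open>S\<close>, computed in a basis of \<open>S\<close>;
  it does not depend on the basis chosen.
\<close>

definition trace_on :: "mat4 set \<Rightarrow> (mat4 \<Rightarrow> mat4) \<Rightarrow> real" where
  "trace_on S f =
     (let B = (SOME B. independent B \<and> span B = S) in \<Sum>b\<in>B. representation B (f b) b)"

definition ad :: "mat4 \<Rightarrow> mat4 \<Rightarrow> mat4" where
  "ad X Y = X ** Y - Y ** X"

definition killing :: "mat4 \<Rightarrow> mat4 \<Rightarrow> real" where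
  "killing X Y = trace_on lie_g (ad X \<circ> ad Y)"


subsection \<open>The dual of \<open>\<tt>\<close>\<close>

text \<open>
  An element \<open>\<Sum>j. \<xi>\<^sub>j e\<^sub>j\<^sup>*\<close> of \<open>\<tt>\<^sup>*\<close> is represented by its coordinate vector, normalised by
  \<open>\<Sum>j. \<xi>\<^sub>j = 0\<close>; \<open>pairing\<close> is its evaluation on \<open>\<tt>\<close>.
\<close>

definition t_dual :: "(real ^ 4) set" where
  "t_dual = {\<xi>. (\<Sum>j\<in>UNIV. \<xi> $ j) = 0}"

definition e_star :: "4 \<Rightarrow> mat4 \<Rightarrow> real" where
  "e_star j H = Im (H $ j $ j)"

definition pairing :: "real ^ 4 \<Rightarrow> mat4 \<Rightarrow> real" where
  "pairing \<xi> H = (\<Sum>j\<in>UNIV. \<xi> $ j * e_star j H)"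

definition t_plus :: "(real ^ 4) set" where
  "t_plus = {\<xi> \<in> t_dual. \<xi> $ 1 \<ge> \<xi> $ 2 \<and> \<xi> $ 3 \<ge> \<xi> $ 4}"

text \<open>For diagonal \<open>H\<close> this is the matrix exponential of \<open>s H\<close>.\<close>

definition exp_diag :: "real \<Rightarrow> mat4 \<Rightarrow> mat4" where
  "exp_diag s H = (\<chi> i j. if i = j then exp (complex_of_real s * H $ i $ i) else 0)"

definition torus_character :: "(mat4 \<Rightarrow> complex) \<Rightarrow> bool" where
  "torus_character c \<longleftrightarrow>
     continuous_on T22 c \<and> c ` T22 \<subseteq> sphere 0 1 \<and>
     (\<forall>a\<in>T22. \<forall>b\<in>T22. c (a ** b) = c a * c b)"

definition weight_lattice :: "(real ^ 4) set" where
  "weight_lattice = {\<alpha> \<in> t_dual. \<exists>c. torus_character c \<and>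
     (\<forall>H\<in>lie_t. ((\<lambda>s. c (exp_diag s H)) has_vector_derivative
                    (\<i> * complex_of_real (pairing \<alpha> H))) (at 0))}"

definition weight_lattice_rat :: "(real ^ 4) set" where
  "weight_lattice_rat = {q *\<^sub>R \<alpha> | q \<alpha>. q \<in> \<rat> \<and> \<alpha> \<in> weight_lattice}"

text \<open>
  The element of \<open>\<tt>\<close> that represents \<open>\<xi>\<close> for the Killing form. Since the Killing form is
  negative definite on \<open>\<tt>\<close>, the inner product it induces on \<open>\<tt>\<^sup>*\<close> carries a minus sign.
\<close>

definition killing_dual :: "real ^ 4 \<Rightarrow> mat4" where
  "killing_dual \<xi> = (THE Z. Z \<in> lie_t \<and> (\<forall>H\<in>lie_t. killing Z H = pairing \<xi> H))"

definition killing_inner :: "real ^ 4 \<Rightarrow> real ^ 4 \<Rightarrow> real" where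
  "killing_inner \<xi> \<eta> = - killing (killing_dual \<xi>) (killing_dual \<eta>)"

definition pos_noncompact_roots :: "(real ^ 4) set" where
  "pos_noncompact_roots = {axis i 1 - axis j 1 | i j. i \<in> {1, 2} \<and> j \<in> {3, 4}}"

definition C_hol :: "(real ^ 4) set" where
  "C_hol = {\<xi> \<in> t_plus. \<forall>\<beta>\<in>pos_noncompact_roots. killing_inner \<xi> \<beta> > 0}"


subsection \<open>Coadjoint orbits and moment polyhedra\<close>

text \<open>
  Elements of \<open>\<gg>\<^sup>*\<close> and \<open>\<kk>\<^sup>*\<close> are functions on matrices restricted to \<open>\<gg>\<close>, respectively
  \<open>\<kk>\<close>. For \<open>V = \<kk>\<close> or \<open>V = \<gg>\<close>, \<open>killing_embed V\<close> is the inclusion \<open>\<tt>\<^sup>* \<subseteq> V\<^sup>*\<close> given by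
  the Killing form of \<open>\<gg>\<close>.
\<close>

definition killing_embed :: "mat4 set \<Rightarrow> real ^ 4 \<Rightarrow> (mat4 \<Rightarrow> real)" where
  "killing_embed V \<xi> = restrict (\<lambda>X. killing (killing_dual \<xi>) X) V"

definition coadjoint :: "mat4 \<Rightarrow> (mat4 \<Rightarrow> real) \<Rightarrow> (mat4 \<Rightarrow> real)" where
  "coadjoint g \<phi> = restrict (\<lambda>X. \<phi> (matrix_inv g ** X ** g)) lie_g"

definition coadjoint_orbit :: "real ^ 4 \<Rightarrow> (mat4 \<Rightarrow> real) set" where
  "coadjoint_orbit \<Lambda> = {coadjoint g (killing_embed lie_g \<Lambda>) | g. g \<in> SU22}"

definition moment_polyhedron :: "(mat4 \<Rightarrow> real) set \<Rightarrow> (real ^ 4) set" where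
  "moment_polyhedron O' =
     {\<xi> \<in> t_plus. killing_embed lie_k \<xi> \<in> (\<lambda>\<phi>. restrict \<phi> lie_k) ` O'}"

end

theory Submission
  imports Defs
begin

text \<open>
  The Killing form is \<open>8 tr (X Y)\<close>, so with \<open>J = I22\<close> a point \<open>\<xi>\<close> of the chamber lies in the moment
  polyhedron iff for some \<open>g\<close> in \<open>SU(2,2)\<close> the two diagonal blocks of the Hermitian matrix
  \<open>g (\<Lambda> J) g\<^sup>*\<close> are those of \<open>\<xi> J\<close>. The rows of \<open>g\<close> form a \<open>J\<close>-orthonormal basis, and \<open>\<Lambda> J\<close> defines a
  second Hermitian form \<open>h\<close> whose eigenvalues relative to \<open>J\<close> are the \<open>\<Lambda>\<^sub>i\<close>.

  Necessity is of Courant--Fischer type: besides the bounds for \<open>h\<close> on \<open>J\<close>-positive and \<open>J\<close>-negative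
  vectors, one bounds the \<open>J\<close>-trace of \<open>h\<close> on a plane of signature \<open>(1,1)\<close> that meets the negative
  eigenspace of \<open>h\<close>.

  For sufficiency a real \<open>g\<close> is enough. Set \<open>a\<^sub>i = \<Lambda>\<^sub>i\<close>, \<open>b\<^sub>1 = -\<Lambda>\<^sub>4\<close>, \<open>b\<^sub>2 = -\<Lambda>\<^sub>3\<close>, \<open>x\<^sub>i = \<xi>\<^sub>i\<close>, \<open>u\<^sub>1 = -\<xi>\<^sub>4\<close>,
  \<open>u\<^sub>2 = -\<xi>\<^sub>3\<close>. One step of a Gelfand--Tsetlin pattern changes \<open>(a\<^sub>2; b\<^sub>1, b\<^sub>2)\<close> into intermediate
  values \<open>(q\<^sub>1, q\<^sub>2)\<close>, a second one changes \<open>(a\<^sub>1; q\<^sub>1, q\<^sub>2)\<close> into \<open>(u\<^sub>1, u\<^sub>2)\<close>. This makes the negative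
  block right for every admissible \<open>(q\<^sub>1, q\<^sub>2)\<close>; the trace of the positive block is then right as well,
  and the intermediate value theorem on the rectangle of admissible \<open>(q\<^sub>1, q\<^sub>2)\<close> gives its discriminant.
  The linear inequalities say precisely that the required discriminant lies between the values at
  the corners. This treats generic \<open>(\<Lambda>, \<xi>)\<close>; the remaining ones follow by compactness.
\<close>

subsection \<open>The Killing form\<close>

text \<open>The identity of \<open>S\<close> factors through the coefficients
  \<open>\<phi> i v\<close>, and a trace is invariant under cyclic permutation of factors. Hence
  \<open>e\<close> may be an overcomplete family, which avoids choosing a basis of
  \<open>lie_g\<close>.\<close>

lemma trace_on_eq_frame:
  fixes f :: "mat4 \<Rightarrow> mat4" and \<phi> :: "'i \<Rightarrow> mat4 \<Rightarrow> real" and e :: "'i \<Rightarrow> mat4"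
  assumes S: "subspace S" and f: "linear f" and \<phi>: "\<And>i. i \<in> I \<Longrightarrow> linear (\<phi> i)"
    and fS: "\<And>v. v \<in> S \<Longrightarrow> f v \<in> S" and eS: "\<And>i. i \<in> I \<Longrightarrow> e i \<in> S"
    and frame: "\<And>v. v \<in> S \<Longrightarrow> v = (\<Sum>i\<in>I. \<phi> i v *\<^sub>R e i)"
  shows "trace_on S f = (\<Sum>i\<in>I. \<phi> i (f (e i)))"
proof -
  define B where "B = (SOME B. independent B \<and> span B = S)"
  obtain B0 where "B0 \<subseteq> S" "independent B0" "S \<subseteq> span B0" "card B0 = dim S"
    using basis_exists by blast
  then have "\<exists>B. independent B \<and> span B = S"
    using S by (metis span_subspace)
  then have "independent B \<and> span B = S" unfolding B_def by (rule someI_ex)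
  then have iB: "independent B" and sB: "span B = S" by auto
  have fin: "finite B" using iB independent_imp_finite by blast
  have rsum: "(\<Sum>b\<in>B. representation B v b *\<^sub>R b) = v" if "v \<in> S" for v
    using sum_representation_eq[OF iB _ fin order_refl] that sB by auto
  have "(\<Sum>b\<in>B. representation B (f b) b) = (\<Sum>b\<in>B. \<Sum>i\<in>I. \<phi> i b * representation B (f (e i)) b)"
  proof (rule sum.cong[OF refl])
    fix b assume "b \<in> B"
    then have bS: "b \<in> S" using sB span_base by blast
    have "f b = f (\<Sum>i\<in>I. \<phi> i b *\<^sub>R e i)" using frame[OF bS] by simp
    also have "\<dots> = (\<Sum>i\<in>I. \<phi> i b *\<^sub>R f (e i))"
      using f by (simp add: linear_sum linear_scale)
    finally have "f b = \<dots>" .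
    then have "representation B (f b) = representation B (\<Sum>i\<in>I. \<phi> i b *\<^sub>R f (e i))" by simp
    also have "\<dots> = (\<lambda>c. \<Sum>i\<in>I. representation B (\<phi> i b *\<^sub>R f (e i)) c)"
      using iB by (intro representation_sum) (auto simp: sB fS eS subspace_scale[OF S])
    also have "\<dots> = (\<lambda>c. \<Sum>i\<in>I. \<phi> i b * representation B (f (e i)) c)"
      using iB sB fS eS by (auto simp: representation_scale intro!: sum.cong ext)
    finally show "representation B (f b) b = (\<Sum>i\<in>I. \<phi> i b * representation B (f (e i)) b)" by simp
  qed
  also have "\<dots> = (\<Sum>i\<in>I. \<Sum>b\<in>B. representation B (f (e i)) b * \<phi> i b)"
    by (subst sum.swap) (simp add: mult.commute)
  also have "\<dots> = (\<Sum>i\<in>I. \<phi> i (\<Sum>b\<in>B. representation B (f (e i)) b *\<^sub>R b))"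
    using \<phi> by (intro sum.cong refl) (simp add: linear_sum linear_scale)
  also have "\<dots> = (\<Sum>i\<in>I. \<phi> i (f (e i)))"
    by (intro sum.cong refl) (simp add: rsum fS eS)
  finally show ?thesis unfolding trace_on_def B_def Let_def .
qed

text \<open>The diagonal of \<open>I22\<close> as real signs. The equation
  \<open>J22 i = J22 j\<close> serves throughout as the test for two indices lying in the same
  diagonal block.\<close>

definition J22 :: "4 \<Rightarrow> real" where
  "J22 i = (if i \<in> {1, 2} then 1 else - 1)"

lemma J22_simps [simp]: "J22 1 = 1" "J22 2 = 1" "J22 3 = - 1" "J22 4 = - 1"
  by (simp_all add: J22_def)

lemma J22_cases: "J22 i = 1 \<or> J22 i = - 1"
  by (simp add: J22_def)

lemma J22_square [simp]: "J22 i * J22 i = 1" "J22 i * (J22 i * x) = x"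
  by (auto simp: J22_def)

lemma of_real_J22_square [simp]:
  "complex_of_real (J22 i) * complex_of_real (J22 i) = 1"
  "complex_of_real (J22 i) * (complex_of_real (J22 i) * z) = z"
  by (auto simp: J22_def)

lemma I22_nth: "I22 $ i $ j = (if i = j then of_real (J22 i) else 0)"
  by (simp add: I22_def J22_def)

lemma matrix_mult_nth: "(A ** B) $ i $ j = (\<Sum>k\<in>UNIV. A $ i $ k * B $ k $ j)"
  by (simp add: matrix_matrix_mult_def)

lemma mult_I22_nth: "(A ** I22) $ i $ j = A $ i $ j * of_real (J22 j)"
  by (simp add: matrix_mult_nth I22_nth if_distrib sum.delta cong: if_cong)

lemma I22_mult_nth: "(I22 ** A) $ i $ j = of_real (J22 i) * A $ i $ j"
  by (simp add: matrix_mult_nth I22_nth if_distrib if_distribR sum.delta' cong: if_cong)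

section \<open>The Lie algebra \<open>lie_g\<close> in coordinates and a projection onto it\<close>

lemma mem_lie_g_iff:
  "X \<in> lie_g \<longleftrightarrow> (\<forall>i j. cnj (X $ j $ i) * of_real (J22 j) + of_real (J22 i) * X $ i $ j = 0) \<and> trace X = 0"
  by (simp add: lie_g_def vec_eq_iff mult_I22_nth I22_mult_nth conj_transpose_def)

lemma lie_g_nth:
  assumes "X \<in> lie_g"
  shows "X $ i $ j = - of_real (J22 i * J22 j) * cnj (X $ j $ i)"
proof -
  have *: "cnj (X $ j $ i) * of_real (J22 j) + of_real (J22 i) * X $ i $ j = 0"
    using assms by (auto simp: mem_lie_g_iff)
  have "X $ i $ j = of_real (J22 i) * (of_real (J22 i) * X $ i $ j)" by simp
  also have "of_real (J22 i) * X $ i $ j = - (cnj (X $ j $ i) * of_real (J22 j))"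
    using * by (simp add: eq_neg_iff_add_eq_0 add.commute)
  finally show ?thesis by simp
qed

lemma lie_g_cnj: "X \<in> lie_g \<Longrightarrow> cnj (X $ i $ j) = - of_real (J22 i * J22 j) * X $ j $ i"
  using lie_g_nth[of X j i] J22_cases[of i] J22_cases[of j]
  by (elim disjE) simp_all

lemma subspace_lie_g: "subspace lie_g"
proof (rule subspaceI)
  show "0 \<in> lie_g" by (simp add: mem_lie_g_iff trace_def)
next
  fix X Y assume X: "X \<in> lie_g" and Y: "Y \<in> lie_g"
  have "cnj ((X + Y) $ j $ i) * of_real (J22 j) + of_real (J22 i) * (X + Y) $ i $ j
      = (cnj (X $ j $ i) * of_real (J22 j) + of_real (J22 i) * X $ i $ j)
      + (cnj (Y $ j $ i) * of_real (J22 j) + of_real (J22 i) * Y $ i $ j)" for i j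
    by (simp add: algebra_simps)
  with X Y show "X + Y \<in> lie_g"
    by (auto simp: mem_lie_g_iff trace_add)
next
  fix c :: real and X assume X: "X \<in> lie_g"
  have "cnj ((c *\<^sub>R X) $ j $ i) * of_real (J22 j) + of_real (J22 i) * (c *\<^sub>R X) $ i $ j
      = of_real c * (cnj (X $ j $ i) * of_real (J22 j) + of_real (J22 i) * X $ i $ j)" for i j
    by (simp add: algebra_simps scaleR_conv_of_real[where 'a=complex])
  moreover have "trace (c *\<^sub>R X) = c *\<^sub>R trace X"
    by (simp add: trace_def scaleR_sum_right)
  ultimately show "c *\<^sub>R X \<in> lie_g"
    using X by (auto simp: mem_lie_g_iff)
qed

lemma ad_mem_lie_g:
  assumes "X \<in> lie_g" "Y \<in> lie_g"
  shows "ad X Y \<in> lie_g"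
proof -
  have "trace (ad X Y) = 0"
    unfolding ad_def trace_sub by (subst trace_mul_sym) simp
  moreover have "cnj (ad X Y $ j $ i) * of_real (J22 j) + of_real (J22 i) * ad X Y $ i $ j = 0" for i j
  proof -
    have "cnj (ad X Y $ j $ i) * of_real (J22 j) + of_real (J22 i) * ad X Y $ i $ j
      = (\<Sum>k\<in>UNIV. (cnj (X $ j $ k) * cnj (Y $ k $ i) - cnj (Y $ j $ k) * cnj (X $ k $ i)) * of_real (J22 j)
          + of_real (J22 i) * (X $ i $ k * Y $ k $ j - Y $ i $ k * X $ k $ j))"
      by (simp add: ad_def matrix_mult_nth) (simp add: sum_subtractf sum.distrib flip: sum_distrib_left sum_distrib_right)
    also have "\<dots> = (\<Sum>k\<in>(UNIV :: 4 set). 0)"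
    proof (rule sum.cong[OF refl])
      fix k :: 4
      show "(cnj (X $ j $ k) * cnj (Y $ k $ i) - cnj (Y $ j $ k) * cnj (X $ k $ i)) * of_real (J22 j)
          + of_real (J22 i) * (X $ i $ k * Y $ k $ j - Y $ i $ k * X $ k $ j) = 0"
        using J22_cases[of i] J22_cases[of j] J22_cases[of k]
        unfolding lie_g_cnj[OF assms(1)] lie_g_cnj[OF assms(2)]
        by (elim disjE) (simp_all add: algebra_simps)
    qed
    finally show ?thesis by simp
  qed
  ultimately show ?thesis unfolding mem_lie_g_iff by blast
qed

text \<open>Averages \<open>Y\<close> with minus its adjoint for the form \<open>I22\<close>. The
  average has trace \<open>(trace Y - cnj (trace Y)) / 2\<close>, hence the eighth removed from each
  of the four diagonal entries.\<close>

definition proj_lie_g :: "mat4 \<Rightarrow> mat4" where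
  "proj_lie_g Y = (\<chi> i j. (Y $ i $ j - of_real (J22 i * J22 j) * cnj (Y $ j $ i)) / 2
      - (if i = j then (trace Y - cnj (trace Y)) / 8 else 0))"

lemma linear_proj_lie_g: "linear proj_lie_g"
  by (rule linearI)
     (auto simp: vec_eq_iff proj_lie_g_def trace_def sum.distrib field_simps
       scaleR_conv_of_real[where 'a=complex] sum_distrib_left)

lemma proj_lie_g_mem: "proj_lie_g Y \<in> lie_g"
proof -
  have "trace (proj_lie_g Y) = 0"
    by (simp add: trace_def proj_lie_g_def sum_4 field_simps)
  moreover have "cnj (proj_lie_g Y $ j $ i) * of_real (J22 j) + of_real (J22 i) * proj_lie_g Y $ i $ j = 0" for i j
  proof -
    show ?thesis
      using J22_cases[of i] J22_cases[of j]
      by (elim disjE; cases "i = j") (simp_all add: proj_lie_g_def field_simps)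
  qed
  ultimately show ?thesis unfolding mem_lie_g_iff by blast
qed

lemma proj_lie_g_id:
  assumes "Y \<in> lie_g"
  shows "proj_lie_g Y = Y"
proof -
  have tr: "trace Y = 0" using assms unfolding mem_lie_g_iff by blast
  have "proj_lie_g Y $ i $ j = Y $ i $ j" for i j
  proof -
    have "of_real (J22 i * J22 j) * cnj (Y $ j $ i) = - Y $ i $ j"
      using lie_g_nth[OF assms, of i j] by (simp only: mult_minus_left minus_minus)
    then show ?thesis unfolding proj_lie_g_def vec_lambda_beta
      by (simp only: tr) simp
  qed
  then show ?thesis by (simp add: vec_eq_iff)
qed

section \<open>The Killing form as a multiple of the trace form\<close>

definition munit :: "4 \<Rightarrow> 4 \<Rightarrow> complex \<Rightarrow> mat4" where
  "munit k l z = (\<chi> i j. if i = k \<and> j = l then z else 0)"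

lemma mult_munit_nth: "(A ** munit k l z) $ i $ j = (if j = l then A $ i $ k * z else 0)"
  by (simp add: matrix_mult_nth munit_def if_distrib sum.delta cong: if_cong)

lemma munit_mult_nth: "(munit k l z ** A) $ i $ j = (if i = k then z * A $ l $ j else 0)"
  by (simp add: matrix_mult_nth munit_def if_distrib if_distribR sum.delta cong: if_cong)

lemma ad_ad_eq: "ad X (ad Y M) = X ** Y ** M - X ** M ** Y - Y ** M ** X + M ** (Y ** X)"
proof -
  have "A ** (B - C) = A ** B - A ** C" "(B - C) ** A = B ** A - C ** A" for A B C :: mat4
    by (simp_all add: vec_eq_iff matrix_mult_nth algebra_simps sum_subtractf)
  then show ?thesis by (simp add: ad_def matrix_mul_assoc)
qed

lemma ad_ad_munit_nth:
  "ad X (ad Y (munit k l z)) $ i $ j = z *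
     ((if j = l then (X ** Y) $ i $ k else 0) - X $ i $ k * Y $ l $ j - Y $ i $ k * X $ l $ j
      + (if i = k then (Y ** X) $ l $ j else 0))"
proof -
  have "(A ** munit k l z ** B) $ i $ j = z * (A $ i $ k * B $ l $ j)" for A B
    by (simp add: matrix_mult_nth[of "A ** munit k l z"] mult_munit_nth if_distrib if_distribR sum.delta
        mult.assoc mult.left_commute cong: if_cong)
  then show ?thesis
    by (simp add: ad_ad_eq mult_munit_nth munit_mult_nth algebra_simps)
qed

lemma linear_ad: "linear (ad X)"
  by (rule linearI)
     (simp_all add: ad_def vec_eq_iff matrix_mult_nth algebra_simps sum.distrib scaleR_sum_right)

lemma ad_mat: "ad X (mat c) = 0"
  by (simp add: ad_def vec_eq_iff matrix_mult_nth mat_def if_distrib if_distribR sum.delta sum.delta'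
      mult.commute cong: if_cong)

text \<open>The trace correction is a scalar matrix, which \<open>ad\<close> annihilates, so only
  the two matrix units contribute to the Killing form.\<close>

lemma proj_lie_g_munit:
  "proj_lie_g (munit k l z) = (1 / 2) *\<^sub>R munit k l z - (J22 k * J22 l / 2) *\<^sub>R munit l k (cnj z)
     - mat ((trace (munit k l z) - cnj (trace (munit k l z))) / 8)"
  by (auto simp: vec_eq_iff proj_lie_g_def munit_def mat_def scaleR_conv_of_real[where 'a=complex])

text \<open>The frame consists of the projections of the matrix units with entry \<open>1\<close> or
  \<open>\<i>\<close>; its coefficients are the real and imaginary parts of the entries. Summation
  gives \<open>8 tr (X Y) - 2 tr X tr Y\<close>, and \<open>X\<close> is trace-free.\<close>

lemma killing_eq:
  assumes X: "X \<in> lie_g" and Y: "Y \<in> lie_g"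
  shows "killing X Y = 8 * Re (trace (X ** Y))"
proof -
  define \<phi> :: "(4 \<times> 4) \<times> bool \<Rightarrow> mat4 \<Rightarrow> real"
    where "\<phi> = (\<lambda>((k, l), c) v. if c then Re (v $ k $ l) else Im (v $ k $ l))"
  define e :: "(4 \<times> 4) \<times> bool \<Rightarrow> mat4"
    where "e = (\<lambda>((k, l), c). proj_lie_g (munit k l (if c then 1 else \<i>)))"
  define f where "f = ad X \<circ> ad Y"
  have lin_f: "linear f"
    unfolding f_def by (intro linear_compose linear_ad)
  have lin_\<phi>: "linear (\<phi> i)" for i
    by (rule linearI) (auto simp: \<phi>_def split: prod.splits)
  have decomp: "v = (\<Sum>i\<in>UNIV. \<phi> i v *\<^sub>R munit (fst (fst i)) (snd (fst i)) (if snd i then 1 else \<i>))" for v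
  proof -
    have "(\<Sum>i\<in>UNIV. \<phi> i v *\<^sub>R munit (fst (fst i)) (snd (fst i)) (if snd i then 1 else \<i>)) $ a $ b = v $ a $ b" for a b
    proof -
      have "(\<Sum>i\<in>UNIV. \<phi> i v *\<^sub>R munit (fst (fst i)) (snd (fst i)) (if snd i then 1 else \<i>)) $ a $ b
        = (\<Sum>kl\<in>UNIV. \<Sum>c\<in>UNIV. (\<phi> (kl, c) v *\<^sub>R munit (fst kl) (snd kl) (if c then 1 else \<i>)) $ a $ b)"
        by (simp add: sum.cartesian_product flip: UNIV_Times_UNIV split_def) (simp add: split_def)
      also have "\<dots> = (\<Sum>kl\<in>UNIV. if kl = (a, b) then v $ a $ b else 0)"
        by (intro sum.cong refl)
           (auto simp: UNIV_bool \<phi>_def munit_def complex_eq_iff split: prod.splits)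
      finally show ?thesis by (simp add: sum.delta)
    qed
    then show ?thesis by (simp add: vec_eq_iff)
  qed
  have frame: "v = (\<Sum>i\<in>UNIV. \<phi> i v *\<^sub>R e i)" if "v \<in> lie_g" for v
  proof -
    have "v = proj_lie_g v" using that by (simp add: proj_lie_g_id)
    also have "\<dots> = (\<Sum>i\<in>UNIV. \<phi> i v *\<^sub>R proj_lie_g (munit (fst (fst i)) (snd (fst i)) (if snd i then 1 else \<i>)))"
      by (subst decomp[of v]) (simp add: linear_sum[OF linear_proj_lie_g] linear_scale[OF linear_proj_lie_g])
    finally show ?thesis by (simp add: e_def split_def)
  qed
  have "killing X Y = (\<Sum>i\<in>UNIV. \<phi> i (f (e i)))"
    unfolding killing_def f_def[symmetric]
  proof (rule trace_on_eq_frame[OF subspace_lie_g lin_f lin_\<phi> _ _ frame])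
    show "f v \<in> lie_g" if "v \<in> lie_g" for v
      using that by (simp add: f_def ad_mem_lie_g X Y)
    show "e i \<in> lie_g" for i
      by (simp add: e_def split_def proj_lie_g_mem)
  qed
  also have "\<dots> = (\<Sum>kl\<in>UNIV. \<Sum>c\<in>UNIV. \<phi> (kl, c) (f (e (kl, c))))"
    by (simp add: sum.cartesian_product flip: UNIV_Times_UNIV)
  also have "\<dots> = (\<Sum>kl\<in>UNIV. Re ((X ** Y) $ fst kl $ fst kl - X $ fst kl $ fst kl * Y $ snd kl $ snd kl
      - Y $ fst kl $ fst kl * X $ snd kl $ snd kl + (Y ** X) $ snd kl $ snd kl))"
  proof (intro sum.cong refl)
    fix kl :: "4 \<times> 4"
    obtain k l where kl: "kl = (k, l)" by (cases kl)
    have fe: "f (e ((k, l), c)) = (1 / 2) *\<^sub>R ad X (ad Y (munit k l z))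
       - (J22 k * J22 l / 2) *\<^sub>R ad X (ad Y (munit l k (cnj z)))"
      if "z = (if c then 1 else \<i>)" for c z
      using that
      by (simp only: f_def e_def split_def fst_conv snd_conv proj_lie_g_munit o_def
          linear_diff[OF linear_ad] linear_scale[OF linear_ad] ad_mat linear_0[OF linear_ad] diff_zero)
    \<comment> \<open>The terms from \<open>munit k l z\<close> are equal for \<open>z = 1\<close>
      and \<open>z = \<i>\<close> and add up; those from the transposed unit are opposite because of
      \<open>cnj z\<close> and cancel.\<close>
    show "(\<Sum>c\<in>UNIV. \<phi> (kl, c) (f (e (kl, c)))) = Re ((X ** Y) $ fst kl $ fst kl - X $ fst kl $ fst kl * Y $ snd kl $ snd kl
      - Y $ fst kl $ fst kl * X $ snd kl $ snd kl + (Y ** X) $ snd kl $ snd kl)"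
      by (simp add: kl UNIV_bool \<phi>_def fe[OF refl] ad_ad_munit_nth)
  qed
  also have "\<dots> = (\<Sum>k\<in>UNIV. \<Sum>l\<in>UNIV. Re ((X ** Y) $ k $ k - X $ k $ k * Y $ l $ l
      - Y $ k $ k * X $ l $ l + (Y ** X) $ l $ l))"
    by (simp add: sum.cartesian_product flip: UNIV_Times_UNIV) (simp add: split_def)
  also have "\<dots> = Re (\<Sum>k\<in>UNIV. \<Sum>l\<in>UNIV. (X ** Y) $ k $ k - X $ k $ k * Y $ l $ l
      - Y $ k $ k * X $ l $ l + (Y ** X) $ l $ l)"
    by simp
  also have "(\<Sum>k\<in>UNIV. \<Sum>l\<in>UNIV. (X ** Y) $ k $ k - X $ k $ k * Y $ l $ l
      - Y $ k $ k * X $ l $ l + (Y ** X) $ l $ l)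
     = 4 * trace (X ** Y) - trace X * trace Y - trace Y * trace X + 4 * trace (Y ** X)"
    unfolding trace_def
    by (simp only: sum.distrib sum_subtractf sum_product) (simp add: sum_distrib_left)
  also have "trace X = 0" using X unfolding mem_lie_g_iff by blast
  also have "trace (Y ** X) = trace (X ** Y)" by (rule trace_mul_sym)
  finally show ?thesis by simp
qed

section \<open>Duality on the torus and the chamber \<open>C_hol\<close>\<close>

lemma lie_t_eq: "lie_t = diag_i ` t_dual"
  by (auto simp: lie_t_def t_dual_def)

lemma lie_t_subset_lie_g: "lie_t \<subseteq> lie_g"
proof
  fix X assume "X \<in> lie_t"
  then obtain h where X: "X = diag_i h" and h: "(\<Sum>j\<in>UNIV. h $ j) = 0"
    by (auto simp: lie_t_def)
  have "trace X = \<i> * of_real (\<Sum>j\<in>UNIV. h $ j)"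
    by (simp add: X trace_def diag_i_def sum_distrib_left)
  with h show "X \<in> lie_g" by (auto simp: mem_lie_g_iff X diag_i_def)
qed

lemma scaleR_mem_t_dual: "\<xi> \<in> t_dual \<Longrightarrow> c *\<^sub>R \<xi> \<in> t_dual"
  by (simp add: t_dual_def flip: sum_distrib_left)

lemma trace_diag_i_mult: "trace (diag_i z ** X) = (\<Sum>k\<in>UNIV. \<i> * of_real (z $ k) * X $ k $ k)"
  by (simp add: trace_def matrix_mult_nth diag_i_def if_distrib if_distribR sum.delta cong: if_cong)

lemma killing_diag_i:
  assumes "z \<in> t_dual" "X \<in> lie_g"
  shows "killing (diag_i z) X = - 8 * (\<Sum>k\<in>UNIV. z $ k * Im (X $ k $ k))"
  using assms lie_t_subset_lie_g
  by (subst killing_eq) (auto simp: lie_t_eq trace_diag_i_mult sum_negf)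

lemma killing_dual_eq:
  assumes "\<xi> \<in> t_dual"
  shows "killing_dual \<xi> = diag_i ((- 1 / 8) *\<^sub>R \<xi>)"
  unfolding killing_dual_def
proof (rule the_equality)
  have t: "(- 1 / 8) *\<^sub>R \<xi> \<in> t_dual"
    using assms by (intro scaleR_mem_t_dual)
  have pair: "killing (diag_i z) (diag_i h) = - 8 * (\<Sum>k\<in>UNIV. z $ k * h $ k)"
    if "z \<in> t_dual" "h \<in> t_dual" for z h
    using that lie_t_subset_lie_g by (subst killing_diag_i) (auto simp: lie_t_eq diag_i_def)
  have pxi: "pairing \<xi> (diag_i h) = (\<Sum>k\<in>UNIV. \<xi> $ k * h $ k)" for h
    by (simp add: pairing_def e_star_def diag_i_def)
  show "diag_i ((- 1 / 8) *\<^sub>R \<xi>) \<in> lie_t \<and>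
    (\<forall>H\<in>lie_t. killing (diag_i ((- 1 / 8) *\<^sub>R \<xi>)) H = pairing \<xi> H)"
    using t by (auto simp: lie_t_eq pair pxi sum_negf simp flip: sum_divide_distrib)
  fix Z assume Z: "Z \<in> lie_t \<and> (\<forall>H\<in>lie_t. killing Z H = pairing \<xi> H)"
  then obtain z where z: "z \<in> t_dual" and Zz: "Z = diag_i z" by (auto simp: lie_t_eq)
  \<comment> \<open>The difference of the two candidates. The form is definite on
    \<open>lie_t\<close>, so testing against \<open>w\<close> itself forces
    \<open>w = 0\<close>.\<close>
  define w where "w = z + (1 / 8) *\<^sub>R \<xi>"
  have w: "w \<in> t_dual"
    using z scaleR_mem_t_dual[OF assms, of "1 / 8"] by (simp add: w_def t_dual_def sum.distrib)
  have "killing Z (diag_i w) = pairing \<xi> (diag_i w)"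
    using Z w by (auto simp: lie_t_eq)
  then have "(\<Sum>k\<in>UNIV. z $ k * w $ k) + (1 / 8) * (\<Sum>k\<in>UNIV. \<xi> $ k * w $ k) = 0"
    by (simp add: Zz pair z w pxi)
  then have "(\<Sum>k\<in>UNIV. w $ k * w $ k) = 0"
    by (simp add: w_def sum_distrib_left sum.distrib distrib_right flip: sum_divide_distrib)
  then have "w = 0"
    by (simp add: sum_nonneg_eq_0_iff vec_eq_iff)
  then have "z = (- 1 / 8) *\<^sub>R \<xi>"
    by (simp add: w_def add_eq_0_iff2)
  then show "Z = diag_i ((- 1 / 8) *\<^sub>R \<xi>)" by (simp add: Zz)
qed

text \<open>The factors \<open>- 8\<close> and \<open>- 1 / 8\<close> cancel, so the normalisation
  of the Killing form disappears from here on.\<close>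

lemma killing_killing_dual:
  assumes "\<xi> \<in> t_dual" "X \<in> lie_g"
  shows "killing (killing_dual \<xi>) X = (\<Sum>k\<in>UNIV. \<xi> $ k * Im (X $ k $ k))"
proof -
  have "(- 1 / 8) *\<^sub>R \<xi> \<in> t_dual"
    using assms by (intro scaleR_mem_t_dual)
  then show ?thesis
    using assms by (simp add: killing_dual_eq killing_diag_i sum_negf flip: sum_divide_distrib)
qed

lemma killing_inner_eq:
  assumes "\<xi> \<in> t_dual" "\<eta> \<in> t_dual"
  shows "killing_inner \<xi> \<eta> = (\<xi> \<bullet> \<eta>) / 8"
proof -
  have "killing_dual \<eta> \<in> lie_g"
    using assms(2) lie_t_subset_lie_g scaleR_mem_t_dual[OF assms(2), of "- 1 / 8"]
    by (simp only: killing_dual_eq lie_t_eq) blast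
  then have "killing_inner \<xi> \<eta> = - (\<Sum>k\<in>UNIV. \<xi> $ k * Im (killing_dual \<eta> $ k $ k))"
    by (simp add: killing_inner_def killing_killing_dual assms)
  then show ?thesis
    by (simp add: killing_dual_eq[OF assms(2)] diag_i_def inner_vec_def sum_negf sum_divide_distrib)
qed

lemma mem_C_hol_iff:
  "\<xi> \<in> C_hol \<longleftrightarrow> \<xi> \<in> t_dual \<and> \<xi> $ 1 \<ge> \<xi> $ 2 \<and> \<xi> $ 2 > \<xi> $ 3 \<and> \<xi> $ 3 \<ge> \<xi> $ 4"
proof -
  have "killing_inner \<xi> (axis i 1 - axis j 1) = (\<xi> $ i - \<xi> $ j) / 8" if "\<xi> \<in> t_dual" for i j
  proof -
    have "axis i 1 - axis j 1 \<in> t_dual"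
      by (simp add: t_dual_def axis_def sum_subtractf)
    with that show ?thesis
      by (simp add: killing_inner_eq inner_diff_right inner_axis)
  qed
  then have "killing_inner \<xi> (axis i 1 - axis j 1) > 0 \<longleftrightarrow> \<xi> $ i > \<xi> $ j" if "\<xi> \<in> t_dual" for i j
    using that by (metis diff_gt_0_iff_gt zero_less_divide_iff zero_less_numeral not_numeral_less_zero)
  moreover have "\<xi> \<in> C_hol \<longleftrightarrow> \<xi> \<in> t_dual \<and> \<xi> $ 1 \<ge> \<xi> $ 2 \<and> \<xi> $ 3 \<ge> \<xi> $ 4 \<and>
      (\<forall>i\<in>{1, 2}. \<forall>j\<in>{3, 4}. killing_inner \<xi> (axis i 1 - axis j 1) > 0)"
    by (auto simp: C_hol_def t_plus_def pos_noncompact_roots_def)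
  ultimately show ?thesis by auto
qed

subsection \<open>The moment condition\<close>

lemma SU22_col_orthonormal:
  assumes "g \<in> SU22"
  shows "(\<Sum>i\<in>UNIV. of_real (J22 i) * cnj (g $ i $ k) * g $ i $ l) = (if k = l then of_real (J22 k) else 0)"
proof -
  have "(\<Sum>i\<in>UNIV. conj_transpose g $ k $ i * of_real (J22 i) * g $ i $ l) = (conj_transpose g ** I22 ** g) $ k $ l"
    by (simp only: matrix_mult_nth[of "conj_transpose g ** I22"] mult_I22_nth)
  also have "\<dots> = I22 $ k $ l"
    using assms by (simp add: SU22_def)
  finally show ?thesis
    by (simp add: I22_nth conj_transpose_def mult_ac)
qed

lemma SU22_inverse:
  assumes "g \<in> SU22"
  shows "matrix_inv g ** g = mat 1" "g ** matrix_inv g = mat 1"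
    "matrix_inv g $ k $ j = of_real (J22 k * J22 j) * cnj (g $ j $ k)"
proof -
  have JJ: "I22 ** I22 = mat 1"
    by (simp add: vec_eq_iff mult_I22_nth I22_nth mat_def)
  define h where "h = I22 ** conj_transpose g ** I22"
  have hg: "h ** g = mat 1"
  proof -
    have "h ** g = I22 ** (conj_transpose g ** I22 ** g)"
      by (simp add: h_def matrix_mul_assoc)
    then show ?thesis using assms JJ by (simp add: SU22_def)
  qed
  then have gh: "g ** h = mat 1" by (simp add: matrix_left_right_inverse)
  have inv: "invertible g" using hg gh unfolding invertible_def by blast
  then have 1: "g ** matrix_inv g = mat 1 \<and> matrix_inv g ** g = mat 1"
    unfolding matrix_inv_def invertible_def by (rule someI_ex)
  then show "matrix_inv g ** g = mat 1" "g ** matrix_inv g = mat 1" by auto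
  have "matrix_inv g = (h ** g) ** matrix_inv g" by (simp add: hg)
  also have "\<dots> = h" using 1 by (simp flip: matrix_mul_assoc)
  finally show "matrix_inv g $ k $ j = of_real (J22 k * J22 j) * cnj (g $ j $ k)"
    by (simp add: h_def mult_I22_nth I22_mult_nth conj_transpose_def)
qed

text \<open>The group is defined by relations between columns; a left inverse of a square matrix is
  also a right inverse, which carries them over to the rows.\<close>

lemma SU22_row_orthonormal:
  assumes "g \<in> SU22"
  shows "(\<Sum>k\<in>UNIV. of_real (J22 k) * g $ i $ k * cnj (g $ j $ k)) = (if i = j then of_real (J22 i) else 0)"
proof -
  have "(g ** matrix_inv g) $ i $ j = of_real (J22 j) * (\<Sum>k\<in>UNIV. of_real (J22 k) * g $ i $ k * cnj (g $ j $ k))"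
    by (simp add: matrix_mult_nth SU22_inverse(3)[OF assms] sum_distrib_left mult_ac)
  then have "of_real (J22 j) * (\<Sum>k\<in>UNIV. of_real (J22 k) * g $ i $ k * cnj (g $ j $ k)) = (if i = j then 1 else 0)"
    by (simp add: SU22_inverse[OF assms] mat_def)
  then have "of_real (J22 j) * (of_real (J22 j) * (\<Sum>k\<in>UNIV. of_real (J22 k) * g $ i $ k * cnj (g $ j $ k)))
      = of_real (J22 j) * (if i = j then 1 else 0)" by (rule arg_cong)
  then show ?thesis by simp
qed

lemma conj_mem_lie_g:
  assumes g: "g \<in> SU22" and X: "X \<in> lie_g"
  shows "matrix_inv g ** X ** g \<in> lie_g"
proof -
  have "trace (matrix_inv g ** X ** g) = trace (g ** (matrix_inv g ** X))"
    by (rule trace_mul_sym)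
  also have "\<dots> = trace X" by (simp add: matrix_mul_assoc SU22_inverse[OF g])
  also have "\<dots> = 0" using X unfolding mem_lie_g_iff by blast
  finally have tr: "trace (matrix_inv g ** X ** g) = 0" .
  have e: "(matrix_inv g ** X ** g) $ i $ j =
     (\<Sum>l\<in>UNIV. \<Sum>k\<in>UNIV. of_real (J22 i * J22 k) * cnj (g $ k $ i) * X $ k $ l * g $ l $ j)" for i j
    by (simp add: matrix_mult_nth[of "matrix_inv g ** X"] matrix_mult_nth[of "matrix_inv g"]
        SU22_inverse[OF g] sum_distrib_left sum_distrib_right mult_ac)
  have "cnj ((matrix_inv g ** X ** g) $ j $ i) * of_real (J22 j) + of_real (J22 i) * (matrix_inv g ** X ** g) $ i $ j = 0" for i j
  proof -
    have "cnj ((matrix_inv g ** X ** g) $ j $ i) * of_real (J22 j)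
        = (\<Sum>l\<in>UNIV. \<Sum>k\<in>UNIV. of_real (J22 k) * g $ k $ j * cnj (X $ k $ l) * cnj (g $ l $ i))"
      unfolding e cnj_sum sum_distrib_right
      using J22_cases[of j] by (intro sum.cong refl) auto
    also have "\<dots> = (\<Sum>k\<in>UNIV. \<Sum>l\<in>UNIV. of_real (J22 k) * g $ k $ j * cnj (X $ k $ l) * cnj (g $ l $ i))"
      by (rule sum.swap)
    also have "\<dots> = (\<Sum>l\<in>UNIV. \<Sum>k\<in>UNIV. - (of_real (J22 k) * cnj (g $ k $ i) * X $ k $ l * g $ l $ j))"
      by (simp add: lie_g_cnj[OF X] mult_ac)
    also have "\<dots> = - (of_real (J22 i) * (matrix_inv g ** X ** g) $ i $ j)"
      by (simp add: e sum_distrib_left sum_negf mult_ac)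
    finally show ?thesis by simp
  qed
  with tr show ?thesis unfolding mem_lie_g_iff by blast
qed

text \<open>The Gram matrix of the rows of \<open>g\<close> for the Hermitian form \<open>h\<close>
  with diagonal entries \<open>\<Lambda> $ k * J22 k\<close>.\<close>

definition herm_form :: "real ^ 4 \<Rightarrow> mat4 \<Rightarrow> 4 \<Rightarrow> 4 \<Rightarrow> complex" where
  "herm_form \<Lambda> g i j = (\<Sum>k\<in>UNIV. of_real (\<Lambda> $ k * J22 k) * g $ i $ k * cnj (g $ j $ k))"

lemma pairing_conj:
  assumes "g \<in> SU22"
  shows "(\<Sum>k\<in>UNIV. \<Lambda> $ k * Im ((matrix_inv g ** X ** g) $ k $ k))
    = Im (\<Sum>i\<in>UNIV. \<Sum>j\<in>UNIV. of_real (J22 i) * herm_form \<Lambda> g j i * X $ i $ j)"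
proof -
  have "(\<Sum>k\<in>UNIV. \<Lambda> $ k * Im ((matrix_inv g ** X ** g) $ k $ k))
     = Im (\<Sum>k\<in>UNIV. of_real (\<Lambda> $ k) * ((matrix_inv g ** X ** g) $ k $ k))"
    by simp
  also have "(\<Sum>k\<in>UNIV. of_real (\<Lambda> $ k) * ((matrix_inv g ** X ** g) $ k $ k))
     = (\<Sum>k\<in>UNIV. \<Sum>j\<in>UNIV. \<Sum>i\<in>UNIV. of_real (J22 i) * (of_real (\<Lambda> $ k * J22 k) * g $ j $ k * cnj (g $ i $ k)) * X $ i $ j)"
    by (simp add: matrix_mult_nth[of "matrix_inv g ** X"] matrix_mult_nth[of "matrix_inv g"]
        SU22_inverse[OF assms] sum_distrib_left sum_distrib_right mult_ac)
  also have "\<dots> = (\<Sum>i\<in>UNIV. \<Sum>j\<in>UNIV. \<Sum>k\<in>UNIV. of_real (J22 i) * (of_real (\<Lambda> $ k * J22 k) * g $ j $ k * cnj (g $ i $ k)) * X $ i $ j)"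
    by (subst sum.swap, subst (2) sum.swap, subst sum.swap) simp
  also have "\<dots> = (\<Sum>i\<in>UNIV. \<Sum>j\<in>UNIV. of_real (J22 i) * herm_form \<Lambda> g j i * X $ i $ j)"
    by (simp add: herm_form_def sum_distrib_left sum_distrib_right)
  finally show ?thesis .
qed

lemma lie_k_nth: "X \<in> lie_k \<Longrightarrow> J22 i \<noteq> J22 j \<Longrightarrow> X $ i $ j = 0"
  using exhaust_4[of i] exhaust_4[of j] by (auto simp: lie_k_def block_diagonal_def)

text \<open>Testing against the block-diagonal part of the difference separates the two functionals.\<close>

lemma mem_moment_polyhedron_iff:
  assumes \<Lambda>: "\<Lambda> \<in> t_dual"
  shows "\<xi> \<in> moment_polyhedron (coadjoint_orbit \<Lambda>) \<longleftrightarrow>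
    \<xi> \<in> t_plus \<and> (\<exists>g\<in>SU22. \<forall>i j. J22 i = J22 j \<longrightarrow> herm_form \<Lambda> g i j = (if i = j then of_real (\<xi> $ i * J22 i) else 0))"
    (is "?L \<longleftrightarrow> ?R")
proof -
  define P where "P g \<longleftrightarrow> (\<forall>X\<in>lie_k. (\<Sum>k\<in>UNIV. \<xi> $ k * Im (X $ k $ k))
      = Im (\<Sum>i\<in>UNIV. \<Sum>j\<in>UNIV. of_real (J22 i) * herm_form \<Lambda> g j i * X $ i $ j))" for g
  have k: "lie_k \<subseteq> lie_g" by (auto simp: lie_k_def)
  have eq: "killing_embed lie_k \<xi> = restrict (coadjoint g (killing_embed lie_g \<Lambda>)) lie_k \<longleftrightarrow> P g"
    if g: "g \<in> SU22" and "\<xi> \<in> t_dual" for g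
  proof -
    have "killing_embed lie_k \<xi> = restrict (coadjoint g (killing_embed lie_g \<Lambda>)) lie_k \<longleftrightarrow>
      (\<forall>X\<in>lie_k. killing_embed lie_k \<xi> X = restrict (coadjoint g (killing_embed lie_g \<Lambda>)) lie_k X)"
      by (auto simp: killing_embed_def fun_eq_iff)
    also have "\<dots> \<longleftrightarrow> P g"
      unfolding P_def
    proof (rule ball_cong[OF refl])
      fix X assume X: "X \<in> lie_k"
      then have Xg: "X \<in> lie_g" using k by auto
      have "killing_embed lie_k \<xi> X = (\<Sum>k\<in>UNIV. \<xi> $ k * Im (X $ k $ k))"
        using X Xg that by (simp add: killing_embed_def killing_killing_dual)
      moreover have "restrict (coadjoint g (killing_embed lie_g \<Lambda>)) lie_k X
          = Im (\<Sum>i\<in>UNIV. \<Sum>j\<in>UNIV. of_real (J22 i) * herm_form \<Lambda> g j i * X $ i $ j)"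
        using X Xg conj_mem_lie_g[OF g Xg]
        by (simp only: coadjoint_def killing_embed_def restrict_apply' killing_killing_dual[OF \<Lambda>] pairing_conj[OF g])
      ultimately show "killing_embed lie_k \<xi> X = restrict (coadjoint g (killing_embed lie_g \<Lambda>)) lie_k X
        \<longleftrightarrow> (\<Sum>k\<in>UNIV. \<xi> $ k * Im (X $ k $ k))
          = Im (\<Sum>i\<in>UNIV. \<Sum>j\<in>UNIV. of_real (J22 i) * herm_form \<Lambda> g j i * X $ i $ j)"
        by simp
    qed
    finally show ?thesis .
  qed
  have 1: "?L \<longleftrightarrow> \<xi> \<in> t_plus \<and> (\<exists>g\<in>SU22. P g)"
  proof -
    have "?L \<longleftrightarrow> \<xi> \<in> t_plus \<and> (\<exists>g\<in>SU22. killing_embed lie_k \<xi> = restrict (coadjoint g (killing_embed lie_g \<Lambda>)) lie_k)"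
      by (auto simp: moment_polyhedron_def coadjoint_orbit_def)
    then show ?thesis using eq by (auto simp: t_plus_def)
  qed
  have 2: "P g \<longleftrightarrow> (\<forall>i j. J22 i = J22 j \<longrightarrow> herm_form \<Lambda> g i j = (if i = j then of_real (\<xi> $ i * J22 i) else 0))"
    if g: "g \<in> SU22" and \<xi>: "\<xi> \<in> t_dual" for g
  proof -
    define N where "N i j = (if J22 i = J22 j then herm_form \<Lambda> g i j - (if i = j then of_real (\<xi> $ i * J22 i) else 0) else 0)" for i j
    have diff: "Im (\<Sum>i\<in>UNIV. \<Sum>j\<in>UNIV. of_real (J22 i) * herm_form \<Lambda> g j i * X $ i $ j) - (\<Sum>k\<in>UNIV. \<xi> $ k * Im (X $ k $ k))
        = Im (\<Sum>i\<in>UNIV. \<Sum>j\<in>UNIV. of_real (J22 i) * N j i * X $ i $ j)" if X: "X \<in> lie_k" for X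
    proof -
      have "(\<Sum>i\<in>UNIV. \<Sum>j\<in>UNIV. of_real (J22 i) * herm_form \<Lambda> g j i * X $ i $ j)
        = (\<Sum>i\<in>UNIV. \<Sum>j\<in>UNIV. of_real (J22 i) * N j i * X $ i $ j + (if j = i then of_real (\<xi> $ i) * X $ i $ i else 0))"
        using lie_k_nth[OF X] by (intro sum.cong refl) (auto simp: N_def algebra_simps)
      also have "\<dots> = (\<Sum>i\<in>UNIV. \<Sum>j\<in>UNIV. of_real (J22 i) * N j i * X $ i $ j) + (\<Sum>i\<in>UNIV. of_real (\<xi> $ i) * X $ i $ i)"
        by (simp add: sum.distrib sum.delta)
      finally show ?thesis by simp
    qed
    have "P g \<longleftrightarrow> (\<forall>i j. N i j = 0)"
    proof
      assume N: "\<forall>i j. N i j = 0"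
      show "P g" unfolding P_def using diff N by fastforce
    next
      assume Pg: "P g"
      \<comment> \<open>\<open>N\<close> is Hermitian, so the factor \<open>\<i>\<close> and the
        signs make \<open>X\<close> an element of the Lie algebra; pairing it with \<open>N\<close>
        yields \<open>\<i>\<close> times the sum of the squared moduli of the entries.\<close>
      define X :: mat4 where "X = (\<chi> i j. \<i> * of_real (J22 i) * N i j)"
      have herm: "cnj (N j i) = N i j" for i j
        by (auto simp: N_def herm_form_def mult_ac)
      \<comment> \<open>By column orthonormality the signed trace of \<open>herm_form\<close> is the
        coordinate sum of \<open>\<Lambda>\<close>; both coordinate sums vanish.\<close>
      have trN: "(\<Sum>i\<in>UNIV. of_real (J22 i) * N i i) = 0"
      proof -
        have "(\<Sum>i\<in>UNIV. of_real (J22 i) * herm_form \<Lambda> g i i)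
           = (\<Sum>k\<in>UNIV. of_real (\<Lambda> $ k * J22 k) * (\<Sum>i\<in>UNIV. of_real (J22 i) * cnj (g $ i $ k) * g $ i $ k))"
          unfolding herm_form_def sum_distrib_left by (subst sum.swap) (simp add: mult_ac)
        also have "\<dots> = of_real (\<Sum>k\<in>UNIV. \<Lambda> $ k)"
          unfolding SU22_col_orthonormal[OF g] by (simp add: mult_ac)
        also have "\<dots> = 0" using \<Lambda> by (simp add: t_dual_def)
        finally have "(\<Sum>i\<in>UNIV. of_real (J22 i) * herm_form \<Lambda> g i i) = 0" .
        moreover have "(\<Sum>i\<in>UNIV. of_real (J22 i) * N i i)
           = (\<Sum>i\<in>UNIV. of_real (J22 i) * herm_form \<Lambda> g i i) - of_real (\<Sum>k\<in>UNIV. \<xi> $ k)"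
          by (simp add: N_def sum_subtractf algebra_simps)
        ultimately show ?thesis using \<xi> by (simp only: t_dual_def mem_Collect_eq of_real_0 diff_self)
      qed
      have "X \<in> lie_g"
        unfolding mem_lie_g_iff
      proof (intro conjI allI)
        show "trace X = 0"
          using trN by (simp add: trace_def X_def mult.assoc flip: sum_distrib_left)
        show "cnj (X $ j $ i) * of_real (J22 j) + of_real (J22 i) * X $ i $ j = 0" for i j
          by (simp add: X_def herm mult_ac)
      qed
      moreover have "block_diagonal X"
        by (auto simp: block_diagonal_def X_def N_def)
      ultimately have X: "X \<in> lie_k" by (simp add: lie_k_def)
      have "Im (\<Sum>i\<in>UNIV. \<Sum>j\<in>UNIV. of_real (J22 i) * N j i * X $ i $ j) = 0"
        using Pg diff[OF X] X by (simp add: P_def)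
      also have "(\<Sum>i\<in>UNIV. \<Sum>j\<in>UNIV. of_real (J22 i) * N j i * X $ i $ j)
          = (\<Sum>i\<in>UNIV. \<Sum>j\<in>UNIV. \<i> * of_real ((cmod (N i j))\<^sup>2))"
      proof (intro sum.cong refl)
        fix i j
        have "of_real (J22 i) * N j i * X $ i $ j = \<i> * (N i j * cnj (N i j))"
          by (simp add: X_def herm mult_ac)
        then show "of_real (J22 i) * N j i * X $ i $ j = \<i> * of_real ((cmod (N i j))\<^sup>2)"
          by (simp only: complex_norm_square)
      qed
      finally have "(\<Sum>i\<in>UNIV. \<Sum>j\<in>UNIV. (cmod (N i j))\<^sup>2) = 0" by simp
      then show "\<forall>i j. N i j = 0"
        by (simp add: sum_nonneg_eq_0_iff sum_nonneg)
    qed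
    then show ?thesis by (auto simp: N_def)
  qed
  have "\<xi> \<in> t_dual" if "\<xi> \<in> t_plus" using that by (simp add: t_plus_def)
  then show ?thesis unfolding 1 using 2 by (metis (no_types, lifting))
qed

subsection \<open>Necessity\<close>

definition qform :: "(4 \<Rightarrow> real) \<Rightarrow> (4 \<Rightarrow> complex) \<Rightarrow> (4 \<Rightarrow> complex) \<Rightarrow> complex" where
  "qform c v w = (\<Sum>k\<in>UNIV. of_real (c k) * v k * cnj (w k))"

lemma qform_lincomb_left: "qform c (\<lambda>k. x * v k + y * w k) u = x * qform c v u + y * qform c w u"
  by (simp add: qform_def sum_distrib_left algebra_simps flip: sum.distrib)

lemma qform_cnj: "cnj (qform c v w) = qform c w v"
  by (simp add: qform_def mult_ac)

lemma qform_lincomb_right: "qform c u (\<lambda>k. x * v k + y * w k) = cnj x * qform c u v + cnj y * qform c u w"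
  by (simp add: qform_def sum_distrib_left algebra_simps flip: sum.distrib)

lemmas qform_lincomb = qform_lincomb_left qform_lincomb_right

lemma qform_self: "qform c v v = of_real (\<Sum>k\<in>UNIV. c k * (cmod (v k))\<^sup>2)"
  by (simp add: qform_def mult.assoc flip: complex_norm_square)

lemma Re_qform_lincomb_self:
  "Re (qform c (\<lambda>k. x * v k + y * w k) (\<lambda>k. x * v k + y * w k)) =
     (cmod x)\<^sup>2 * Re (qform c v v) + (cmod y)\<^sup>2 * Re (qform c w w) + 2 * Re (x * cnj y * qform c v w)"
proof -
  have "qform c w v = cnj (qform c v w)" by (simp add: qform_cnj)
  moreover have "Im (qform c v v) = 0" "Im (qform c w w) = 0" by (simp_all add: qform_self)
  ultimately show ?thesis
    by (simp add: qform_lincomb cmod_def power2_eq_square algebra_simps)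
qed

text \<open>The normalisation ensures that the combination of two \<open>J22\<close>-orthonormal
  vectors of equal sign again has \<open>J22\<close>-norm 1 or -1.\<close>

lemma homogeneous_1_2:
  fixes a b :: complex
  shows "\<exists>x y. (cmod x)\<^sup>2 + (cmod y)\<^sup>2 = 1 \<and> x * a + y * b = 0"
proof (cases "a = 0")
  case True
  show ?thesis by (rule exI[of _ 1], intro exI[of _ 0]) (use True in simp)
next
  case False
  define n where "n = sqrt ((cmod a)\<^sup>2 + (cmod b)\<^sup>2)"
  have n: "n\<^sup>2 = (cmod a)\<^sup>2 + (cmod b)\<^sup>2" "n \<noteq> 0"
    using False by (simp_all add: n_def add_nonneg_eq_0_iff)
  show ?thesis
  proof (intro exI conjI)
    show "(cmod (b / of_real n))\<^sup>2 + (cmod (- a / of_real n))\<^sup>2 = 1"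
      using n False by (simp only: norm_divide norm_minus_cancel norm_of_real power_divide power2_abs)
        (simp add: divide_simps)
    show "b / of_real n * a + - a / of_real n * b = 0" by simp
  qed
qed

text \<open>If \<open>a1\<close> is nonzero, elimination leaves one equation in \<open>y\<close> and
  \<open>z\<close>, and the first equation then determines \<open>x\<close>. The remaining cases
  exchange the equations or use the first unknown alone.\<close>

lemma homogeneous_2_3:
  fixes a1 :: complex
  shows "\<exists>x y z. (x \<noteq> 0 \<or> y \<noteq> 0 \<or> z \<noteq> 0) \<and> x * a1 + y * a2 + z * a3 = 0 \<and> x * b1 + y * b2 + z * b3 = 0"
proof -
  have *: "\<exists>x y z. (x \<noteq> 0 \<or> y \<noteq> 0 \<or> z \<noteq> 0) \<and> x * a1 + y * a2 + z * a3 = 0 \<and> x * b1 + y * b2 + z * b3 = 0"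
    if a: "a1 \<noteq> 0" for a1 a2 a3 b1 b2 b3 :: complex
  proof -
    obtain y z where yz: "(cmod y)\<^sup>2 + (cmod z)\<^sup>2 = 1"
        "y * (a1 * b2 - b1 * a2) + z * (a1 * b3 - b1 * a3) = 0"
      using homogeneous_1_2 by blast
    from yz(1) have nz: "y \<noteq> 0 \<or> z \<noteq> 0" by auto
    show ?thesis
      by (rule exI[of _ "- (y * a2 + z * a3)"], rule exI[of _ "a1 * y"], rule exI[of _ "a1 * z"])
         (use a nz yz(2) in \<open>simp add: algebra_simps\<close>)
  qed
  show ?thesis
  proof (cases "a1 = 0 \<and> b1 = 0")
    case True
    show ?thesis by (rule exI[of _ 1], intro exI[of _ 0]) (use True in auto)
  next
    case False
    then show ?thesis using *[of a1 a2 a3 b1 b2 b3] *[of b1 b2 b3 a1 a2 a3] by blast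
  qed
qed

text \<open>In the plane spanned by \<open>v\<close> and \<open>w\<close>, the vector \<open>m v + cnj \<alpha> w\<close> is \<open>J\<close>-orthogonal to
  \<open>\<alpha> v + w\<close>, and the \<open>J\<close>-trace of the form \<open>h\<close> can be computed in either orthogonal basis.\<close>

lemma trace_lower_bound:
  assumes vv: "Re (qform J v v) = 1" and ww: "Re (qform J w w) = - m" and vw: "qform J v w = 0"
    and \<alpha>: "(cmod \<alpha>)\<^sup>2 < m"
    and z: "Re (qform h (\<lambda>k. \<alpha> * v k + 1 * w k) (\<lambda>k. \<alpha> * v k + 1 * w k)) \<le> q * (m - (cmod \<alpha>)\<^sup>2)"
    and pos: "\<And>x y. p * Re (qform J (\<lambda>k. x * v k + y * w k) (\<lambda>k. x * v k + y * w k))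
       \<le> Re (qform h (\<lambda>k. x * v k + y * w k) (\<lambda>k. x * v k + y * w k))"
    and w: "u * m \<le> Re (qform h w w)"
  shows "p - q \<le> Re (qform h v v) - u"
proof -
  define H K where "H = Re (qform h v v)" and "K = Re (qform h w w)"
  define N where "N = m - (cmod \<alpha>)\<^sup>2"
  have m: "m > 0" and N: "N > 0"
    using \<alpha> zero_le_power2[of "cmod \<alpha>"] unfolding N_def by linarith+
  \<comment> \<open>This is the lower bound at \<open>m v + cnj \<alpha> w\<close>. Subtracting
    \<open>m\<close> times the upper bound at \<open>\<alpha> v + w\<close> removes the cross term
    and leaves the factor \<open>N\<close> on both sides.\<close>
  have "p * (m\<^sup>2 - (cmod \<alpha>)\<^sup>2 * m) \<le> m\<^sup>2 * H + (cmod \<alpha>)\<^sup>2 * K + 2 * Re (of_real m * \<alpha> * qform h v w)"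
    using pos[of "of_real m" "cnj \<alpha>"] m
    by (simp add: Re_qform_lincomb_self vv ww vw H_def K_def del: Re_complex_of_real)
  moreover have "(cmod \<alpha>)\<^sup>2 * H + K + 2 * Re (\<alpha> * qform h v w) \<le> q * N"
    using z unfolding Re_qform_lincomb_self H_def K_def N_def by (simp del: times_complex.sel)
  then have "m * ((cmod \<alpha>)\<^sup>2 * H + K + 2 * Re (\<alpha> * qform h v w)) \<le> m * (q * N)"
    using m by (intro mult_left_mono) auto
  moreover have "Re (of_real m * \<alpha> * qform h v w) = m * Re (\<alpha> * qform h v w)"
    by (simp add: algebra_simps)
  ultimately have "N * (m * p - m * q) \<le> N * (m * H - K)"
    by (simp add: N_def algebra_simps power2_eq_square)
  then have "m * p - m * q \<le> m * H - K" using N by simp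
  with w have "m * (p - q) \<le> m * (H - u)" by (simp add: K_def algebra_simps)
  with m show ?thesis by (simp add: H_def)
qed

text \<open>Here \<open>d\<close> and \<open>e\<close> stand for \<open>\<Lambda>\<close> and
  \<open>\<xi>\<close> multiplied by the signs \<open>J22\<close>. The first two bounds come from
  lower bounds of \<open>h\<close> on \<open>J22\<close>-positive vectors; the other two apply
  \<open>trace_lower_bound\<close> to a plane containing a nonzero vector supported on coordinates 3
  and 4.\<close>

lemma necessary_inequalities:
  fixes g :: "4 \<Rightarrow> 4 \<Rightarrow> complex"
  assumes J: "\<And>i j. qform J22 (g i) (g j) = (if i = j then of_real (J22 i) else 0)"
    and h: "\<And>i j. J22 i = J22 j \<Longrightarrow> qform d (g i) (g j) = (if i = j then of_real (e i) else 0)"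
    and d: "d 1 \<ge> d 2" "d 4 \<ge> d 3" "d 2 + d 3 > 0" and e: "e 1 \<ge> e 2" "e 4 \<ge> e 3"
  shows "d 1 \<le> e 1" "d 2 \<le> e 2" "d 2 - d 4 \<le> e 2 - e 3" "d 1 - d 4 \<le> e 1 - e 3"
proof -
  have Jz: "Re (qform J22 z z) = (cmod (z 1))\<^sup>2 + (cmod (z 2))\<^sup>2 - (cmod (z 3))\<^sup>2 - (cmod (z 4))\<^sup>2" for z
    by (simp add: qform_self sum_4)
  have hz: "Re (qform d z z) = d 1 * (cmod (z 1))\<^sup>2 + d 2 * (cmod (z 2))\<^sup>2 + d 3 * (cmod (z 3))\<^sup>2 + d 4 * (cmod (z 4))\<^sup>2" for z
    by (simp add: qform_self sum_4)
  have lower: "d 2 * Re (qform J22 z z) \<le> Re (qform d z z)" for z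
  proof -
    have "0 \<le> (d 1 - d 2) * (cmod (z 1))\<^sup>2" "0 \<le> (d 2 + d 3) * (cmod (z 3))\<^sup>2" "0 \<le> (d 2 + d 4) * (cmod (z 4))\<^sup>2"
      using d by auto
    then show ?thesis unfolding Jz hz by (simp add: algebra_simps)
  qed
  have lower1: "d 1 * Re (qform J22 z z) \<le> Re (qform d z z)" if "z 2 = 0" for z
  proof -
    have "0 \<le> (d 1 + d 3) * (cmod (z 3))\<^sup>2" "0 \<le> (d 1 + d 4) * (cmod (z 4))\<^sup>2"
      using d by auto
    then show ?thesis unfolding Jz hz using that by (simp add: algebra_simps)
  qed
  have upper: "Re (qform d z z) \<le> d 4 * - Re (qform J22 z z)" if "z 1 = 0" "z 2 = 0" for z
  proof -
    have "0 \<le> (d 4 - d 3) * (cmod (z 3))\<^sup>2"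
      using d by auto
    then show ?thesis unfolding Jz hz using that by (simp add: algebra_simps)
  qed
  \<comment> \<open>A nonzero vector supported on coordinates 3 and 4 is
    \<open>J22\<close>-negative; a nonvanishing product with some \<open>y\<close> certifies that it
    is nonzero.\<close>
  have neg: "Re (qform J22 z z) < 0" if "z 1 = 0" "z 2 = 0" "qform J22 z y \<noteq> 0" for z y
  proof -
    have "z 3 \<noteq> 0 \<or> z 4 \<noteq> 0" using that by (auto simp: qform_def sum_4)
    then have "0 < (cmod (z 3))\<^sup>2 + (cmod (z 4))\<^sup>2"
      by (auto intro: add_pos_nonneg add_nonneg_pos)
    then show ?thesis unfolding Jz using that by simp
  qed
  have upos: "e 3 * ((cmod x)\<^sup>2 + (cmod y)\<^sup>2) \<le> Re (qform d (\<lambda>k. x * g 3 k + y * g 4 k) (\<lambda>k. x * g 3 k + y * g 4 k))" for x y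
    using mult_right_mono[OF e(2), of "(cmod y)\<^sup>2"]
    by (simp add: Re_qform_lincomb_self h algebra_simps)
  have Jneg: "Re (qform J22 (\<lambda>k. x * g 3 k + y * g 4 k) (\<lambda>k. x * g 3 k + y * g 4 k)) = - ((cmod x)\<^sup>2 + (cmod y)\<^sup>2)" for x y
    by (simp add: Re_qform_lincomb_self J)

  show "d 2 \<le> e 2" using lower[of "g 2"] by (simp add: J h)

  \<comment> \<open>The unit vector of the span of \<open>g 1\<close> and \<open>g 2\<close> with
    vanishing second coordinate has the improved lower bound \<open>d 1\<close> and still the upper
    bound \<open>e 1\<close>.\<close>
  obtain s t where st: "(cmod s)\<^sup>2 + (cmod t)\<^sup>2 = 1" "s * g 1 2 + t * g 2 2 = 0"
    using homogeneous_1_2 by blast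
  define v where "v = (\<lambda>k. s * g 1 k + t * g 2 k)"
  have Jv: "Re (qform J22 v v) = 1" by (simp add: v_def Re_qform_lincomb_self J st)
  have hv: "Re (qform d v v) \<le> e 1"
  proof -
    have "Re (qform d v v) = (cmod s)\<^sup>2 * e 1 + (cmod t)\<^sup>2 * e 2"
      by (simp add: v_def Re_qform_lincomb_self h)
    also have "\<dots> \<le> (cmod s)\<^sup>2 * e 1 + (cmod t)\<^sup>2 * e 1"
      using mult_left_mono[OF e(1), of "(cmod t)\<^sup>2"] by simp
    also have "\<dots> = ((cmod s)\<^sup>2 + (cmod t)\<^sup>2) * e 1" by (rule distrib_right[symmetric])
    finally show ?thesis using st(1) by simp
  qed
  have v2: "v 2 = 0" using st(2) by (simp add: v_def)
  show "d 1 \<le> e 1" using lower1[of v] v2 Jv hv by simp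

  show "d 2 - d 4 \<le> e 2 - e 3"
  proof -
    \<comment> \<open>Three unknowns and two equations: the span of \<open>g 2\<close>,
      \<open>g 3\<close>, \<open>g 4\<close> meets the space of vectors supported on coordinates 3
      and 4.\<close>
    obtain \<alpha> x y where nz: "\<alpha> \<noteq> 0 \<or> x \<noteq> 0 \<or> y \<noteq> 0"
      and z1: "\<alpha> * g 2 1 + x * g 3 1 + y * g 4 1 = 0" and z2: "\<alpha> * g 2 2 + x * g 3 2 + y * g 4 2 = 0"
      using homogeneous_2_3[of "g 2 1" "g 3 1" "g 4 1" "g 2 2" "g 3 2" "g 4 2"] by blast
    define w where "w = (\<lambda>k. x * g 3 k + y * g 4 k)"
    define z where "z = (\<lambda>k. \<alpha> * g 2 k + 1 * w k)"
    have z0: "z 1 = 0" "z 2 = 0" using z1 z2 by (simp_all add: z_def w_def add.assoc)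
    have "qform J22 z (g 2) = \<alpha>" "qform J22 z (g 3) = - x" "qform J22 z (g 4) = - y"
      unfolding z_def qform_lincomb_left by (simp_all add: w_def qform_lincomb_left J)
    then have Jz: "Re (qform J22 z z) < 0"
      using nz neg[of z "g 2"] neg[of z "g 3"] neg[of z "g 4"] z0 by auto
    have Jzz: "Re (qform J22 z z) = (cmod \<alpha>)\<^sup>2 - ((cmod x)\<^sup>2 + (cmod y)\<^sup>2)"
    proof -
      have "qform J22 (g 2) w = 0" by (simp add: w_def qform_lincomb_right J)
      moreover have "Re (qform J22 w w) = - ((cmod x)\<^sup>2 + (cmod y)\<^sup>2)" unfolding w_def by (rule Jneg)
      ultimately show ?thesis unfolding z_def Re_qform_lincomb_self by (simp add: J)
    qed
    have "d 2 - d 4 \<le> Re (qform d (g 2) (g 2)) - e 3"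
    proof (rule trace_lower_bound[of J22 _ w "(cmod x)\<^sup>2 + (cmod y)\<^sup>2" \<alpha>])
      show "Re (qform d (\<lambda>k. \<alpha> * g 2 k + 1 * w k) (\<lambda>k. \<alpha> * g 2 k + 1 * w k)) \<le> d 4 * ((cmod x)\<^sup>2 + (cmod y)\<^sup>2 - (cmod \<alpha>)\<^sup>2)"
        using upper[of z, OF z0] unfolding Jzz z_def[symmetric] by (simp only: minus_diff_eq)
      show "(cmod \<alpha>)\<^sup>2 < (cmod x)\<^sup>2 + (cmod y)\<^sup>2" using Jz Jzz by simp
      show "qform J22 (g 2) w = 0" by (simp add: w_def qform_lincomb_right J)
      show "e 3 * ((cmod x)\<^sup>2 + (cmod y)\<^sup>2) \<le> Re (qform d w w)" unfolding w_def by (rule upos)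
      show "Re (qform J22 w w) = - ((cmod x)\<^sup>2 + (cmod y)\<^sup>2)" unfolding w_def by (rule Jneg)
    qed (simp add: J, rule lower)
    then show ?thesis by (simp add: h)
  qed

  show "d 1 - d 4 \<le> e 1 - e 3"
  proof -
    \<comment> \<open>Like \<open>v\<close>, the vector \<open>w0\<close> gets second coordinate
      zero, so \<open>lower1\<close> holds on the whole plane of \<open>v\<close> and
      \<open>w0\<close>. One more equation then removes the first coordinate.\<close>
    obtain x y where xy: "(cmod x)\<^sup>2 + (cmod y)\<^sup>2 = 1" "x * g 3 2 + y * g 4 2 = 0"
      using homogeneous_1_2 by blast
    define w0 where "w0 = (\<lambda>k. x * g 3 k + y * g 4 k)"
    have w02: "w0 2 = 0" using xy(2) by (simp add: w0_def)
    obtain \<alpha> \<beta> where \<alpha>\<beta>: "(cmod \<alpha>)\<^sup>2 + (cmod \<beta>)\<^sup>2 = 1" "\<alpha> * v 1 + \<beta> * w0 1 = 0"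
      using homogeneous_1_2 by blast
    define w where "w = (\<lambda>k. (\<beta> * x) * g 3 k + (\<beta> * y) * g 4 k)"
    have w: "w k = \<beta> * w0 k" for k by (simp add: w_def w0_def algebra_simps)
    define z where "z = (\<lambda>k. \<alpha> * v k + 1 * w k)"
    have z0: "z 1 = 0" "z 2 = 0" using \<alpha>\<beta> w02 v2 by (simp_all add: z_def w)
    have m: "(cmod (\<beta> * x))\<^sup>2 + (cmod (\<beta> * y))\<^sup>2 = (cmod \<beta>)\<^sup>2"
      using xy(1) distrib_left[of "(cmod \<beta>)\<^sup>2" "(cmod x)\<^sup>2" "(cmod y)\<^sup>2"]
      by (simp add: norm_mult power_mult_distrib)
    have Jvw: "qform J22 v w = 0" "qform J22 w v = 0" by (simp_all add: v_def w_def qform_lincomb J)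
    have Jvv: "qform J22 v v = 1" using Jv by (simp add: qform_self)
    have Jww: "Re (qform J22 w w) = - (cmod \<beta>)\<^sup>2"
      unfolding w_def Jneg m ..
    have "qform J22 z v = \<alpha>" unfolding z_def qform_lincomb_left by (simp add: Jvw Jvv)
    moreover have "qform J22 z (g 3) = - \<beta> * x" "qform J22 z (g 4) = - \<beta> * y"
      unfolding z_def qform_lincomb_left by (simp_all add: w_def v_def qform_lincomb_left J)
    moreover have "\<alpha> \<noteq> 0 \<or> \<beta> * x \<noteq> 0 \<or> \<beta> * y \<noteq> 0"
      using xy \<alpha>\<beta> by (auto simp: power2_eq_square)
    ultimately have "Re (qform J22 z z) < 0"
      using neg[of z v] neg[of z "g 3"] neg[of z "g 4"] z0 by auto
    moreover have Jzz: "Re (qform J22 z z) = (cmod \<alpha>)\<^sup>2 - (cmod \<beta>)\<^sup>2"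
      unfolding z_def Re_qform_lincomb_self by (simp add: Jvv Jww Jvw)
    ultimately have lt: "(cmod \<alpha>)\<^sup>2 < (cmod \<beta>)\<^sup>2" by simp
    have "d 1 - d 4 \<le> Re (qform d v v) - e 3"
    proof (rule trace_lower_bound[of J22 v w "(cmod \<beta>)\<^sup>2" \<alpha>])
      show "Re (qform d (\<lambda>k. \<alpha> * v k + 1 * w k) (\<lambda>k. \<alpha> * v k + 1 * w k)) \<le> d 4 * ((cmod \<beta>)\<^sup>2 - (cmod \<alpha>)\<^sup>2)"
        using upper[of z, OF z0] unfolding Jzz z_def[symmetric] by (simp only: minus_diff_eq)
      show "e 3 * (cmod \<beta>)\<^sup>2 \<le> Re (qform d w w)"
        using upos[of "\<beta> * x" "\<beta> * y"] unfolding m w_def .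
      show "d 1 * Re (qform J22 (\<lambda>k. x * v k + y * w k) (\<lambda>k. x * v k + y * w k))
        \<le> Re (qform d (\<lambda>k. x * v k + y * w k) (\<lambda>k. x * v k + y * w k))" for x y
        by (rule lower1) (simp add: v2 w w02)
    qed (use Jv Jvw Jww lt in auto)
    then show ?thesis using hv by simp
  qed
qed

subsection \<open>Sufficiency\<close>

text \<open>The function \<open>F t = (t + q1) (t + q2) / ((t - a) (t + b1) (t + b2))\<close> has
  residues \<open>P0\<close>, \<open>- P1\<close>, \<open>- P2\<close> at \<open>a\<close>,
  \<open>- b1\<close>, \<open>- b2\<close>. The first and last identities express its behaviour at
  infinity, the second and third its zeros \<open>- q1\<close> and \<open>- q2\<close>, the fourth
  their divided difference, and the two with squares its derivative at the zeros.\<close>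

lemma residue_identities:
  fixes a :: real
  assumes ne: "a + b1 \<noteq> 0" "a + b2 \<noteq> 0" "b1 \<noteq> b2" "a + q1 \<noteq> 0" "a + q2 \<noteq> 0" "q1 \<noteq> q2"
     "q1 \<noteq> b1" "q1 \<noteq> b2" "q2 \<noteq> b1" "q2 \<noteq> b2"
  and P0: "P0 = (a + q1) * (a + q2) / ((a + b1) * (a + b2))"
  and P1: "P1 = (q1 - b1) * (b1 - q2) / ((a + b1) * (b1 - b2))"
  and P2: "P2 = (q1 - b2) * (q2 - b2) / ((a + b2) * (b1 - b2))"
  shows "P0 - P1 - P2 = 1"
    and "P0 / (a + q1) - P1 / (q1 - b1) - P2 / (q1 - b2) = 0"
    and "P0 / (a + q2) - P1 / (q2 - b1) - P2 / (q2 - b2) = 0"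
    and "P0 / (a + q1) / (a + q2) - P1 / (q1 - b1) / (q2 - b1) - P2 / (q1 - b2) / (q2 - b2) = 0"
    and "(a + q1) * (q1 - b1) * (q1 - b2) / (q1 - q2) * (P0 / (a + q1) ^ 2 - P1 / (q1 - b1) ^ 2 - P2 / (q1 - b2) ^ 2) = - 1"
    and "(a + q2) * (b1 - q2) * (q2 - b2) / (q1 - q2) * (P0 / (a + q2) ^ 2 - P1 / (q2 - b1) ^ 2 - P2 / (q2 - b2) ^ 2) = - 1"
    and "a * P0 + b1 * P1 + b2 * P2 = a + q1 + q2 - b1 - b2"
proof -
  have ne': "b1 - b2 \<noteq> 0" "q1 - q2 \<noteq> 0" "q1 - b1 \<noteq> 0" "q1 - b2 \<noteq> 0" "q2 - b1 \<noteq> 0" "q2 - b2 \<noteq> 0"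
    using ne by auto
  show "P0 - P1 - P2 = 1"
    unfolding P0 P1 P2 using ne ne' by (simp add: divide_simps) algebra
  show "a * P0 + b1 * P1 + b2 * P2 = a + q1 + q2 - b1 - b2"
    unfolding P0 P1 P2 using ne ne' by (simp add: divide_simps) algebra
  have Q0: "P0 / (a + q1) = (a + q2) / ((a + b1) * (a + b2))" "P0 / (a + q2) = (a + q1) / ((a + b1) * (a + b2))"
    "P0 / (a + q1) / (a + q2) = 1 / ((a + b1) * (a + b2))"
    using ne by (simp_all add: P0)
  have Q1: "P1 / (q1 - b1) = (b1 - q2) / ((a + b1) * (b1 - b2))" "P1 / (q2 - b1) = - (q1 - b1) / ((a + b1) * (b1 - b2))"
    "P1 / (q1 - b1) / (q2 - b1) = - 1 / ((a + b1) * (b1 - b2))"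
    using ne ne' by (simp_all add: P1 divide_simps) (simp_all add: algebra_simps)
  have Q2: "P2 / (q1 - b2) = (q2 - b2) / ((a + b2) * (b1 - b2))" "P2 / (q2 - b2) = (q1 - b2) / ((a + b2) * (b1 - b2))"
    "P2 / (q1 - b2) / (q2 - b2) = 1 / ((a + b2) * (b1 - b2))"
    using ne ne' by (simp_all add: P2)
  show "P0 / (a + q1) - P1 / (q1 - b1) - P2 / (q1 - b2) = 0"
    unfolding Q0 Q1 Q2 using ne ne' by (simp add: divide_simps) algebra
  show "P0 / (a + q2) - P1 / (q2 - b1) - P2 / (q2 - b2) = 0"
    unfolding Q0 Q1 Q2 using ne ne' by (simp add: divide_simps) algebra
  show "P0 / (a + q1) / (a + q2) - P1 / (q1 - b1) / (q2 - b1) - P2 / (q1 - b2) / (q2 - b2) = 0"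
    unfolding Q0 Q1 Q2 using ne ne' by (simp add: divide_simps) algebra
  show "(a + q1) * (q1 - b1) * (q1 - b2) / (q1 - q2) * (P0 / (a + q1) ^ 2 - P1 / (q1 - b1) ^ 2 - P2 / (q1 - b2) ^ 2) = - 1"
    unfolding power2_eq_square divide_divide_eq_left[symmetric] Q0 Q1 Q2 using ne ne' by (simp add: divide_simps) algebra
  show "(a + q2) * (b1 - q2) * (q2 - b2) / (q1 - q2) * (P0 / (a + q2) ^ 2 - P1 / (q2 - b1) ^ 2 - P2 / (q2 - b2) ^ 2) = - 1"
    unfolding power2_eq_square divide_divide_eq_left[symmetric] Q0 Q1 Q2 using ne ne' by (simp add: divide_simps) algebra
qed

section \<open>Real bilinear forms and one interlacing step\<close>

definition rform :: "(4 \<Rightarrow> real) \<Rightarrow> (4 \<Rightarrow> real) \<Rightarrow> (4 \<Rightarrow> real) \<Rightarrow> real" where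
  "rform c v w = (\<Sum>k\<in>UNIV. c k * v k * w k)"

lemma rform_commute: "rform c v w = rform c w v"
  by (simp add: rform_def mult_ac)

lemma rform_lincomb2:
  "rform c (\<lambda>k. x * v k + y * w k) u = x * rform c v u + y * rform c w u"
  "rform c u (\<lambda>k. x * v k + y * w k) = x * rform c u v + y * rform c u w"
  by (simp_all add: rform_def sum_distrib_left algebra_simps flip: sum.distrib)

lemma rform_lincomb3:
  "rform c (\<lambda>k. x * v k + y * w k + z * t k) u = x * rform c v u + y * rform c w u + z * rform c t u"
  "rform c u (\<lambda>k. x * v k + y * w k + z * t k) = x * rform c u v + y * rform c u w + z * rform c u t"
  by (simp_all add: rform_def sum_distrib_left algebra_simps flip: sum.distrib)

text \<open>The inverse problem for one step of a Gelfand--Tsetlin pattern of signature \<open>(1, 2)\<close>: given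
  the eigenvalues \<open>a\<close>, \<open>- b1\<close>, \<open>- b2\<close> of \<open>h\<close> with respect to \<open>J\<close>, the squares of the coordinates
  of \<open>r\<close> are the residues that produce the eigenvalues \<open>- q1\<close>, \<open>- q2\<close> on the complement of \<open>r\<close>.\<close>

lemma gelfand_tsetlin_step:
  fixes a :: real
  assumes J: "rform J f f = 1" "rform J g1 g1 = - 1" "rform J g2 g2 = - 1"
      "rform J f g1 = 0" "rform J f g2 = 0" "rform J g1 g2 = 0"
    and h: "rform h f f = a" "rform h g1 g1 = b1" "rform h g2 g2 = b2"
      "rform h f g1 = 0" "rform h f g2 = 0" "rform h g1 g2 = 0"
    and ne: "a + b1 \<noteq> 0" "a + b2 \<noteq> 0" "b1 \<noteq> b2" "a + q1 \<noteq> 0" "a + q2 \<noteq> 0" "q1 \<noteq> q2"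
     "q1 \<noteq> b1" "q1 \<noteq> b2" "q2 \<noteq> b1" "q2 \<noteq> b2"
    and d0: "d0\<^sup>2 = (a + q1) * (a + q2) / ((a + b1) * (a + b2))"
    and d1: "d1\<^sup>2 = (q1 - b1) * (b1 - q2) / ((a + b1) * (b1 - b2))"
    and d2: "d2\<^sup>2 = (q1 - b2) * (q2 - b2) / ((a + b2) * (b1 - b2))"
    and k1: "k1\<^sup>2 = (a + q1) * (q1 - b1) * (q1 - b2) / (q1 - q2)"
    and k2: "k2\<^sup>2 = (a + q2) * (b1 - q2) * (q2 - b2) / (q1 - q2)"
  defines "r \<equiv> \<lambda>k. d0 * f k + d1 * g1 k + d2 * g2 k"
    and "n1 \<equiv> \<lambda>k. (k1 * (d0 / (a + q1))) * f k + (k1 * (d1 / (q1 - b1))) * g1 k + (k1 * (d2 / (q1 - b2))) * g2 k"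
    and "n2 \<equiv> \<lambda>k. (k2 * (d0 / (a + q2))) * f k + (k2 * (d1 / (q2 - b1))) * g1 k + (k2 * (d2 / (q2 - b2))) * g2 k"
  shows "rform J r r = 1" "rform J n1 n1 = - 1" "rform J n2 n2 = - 1"
    "rform J r n1 = 0" "rform J r n2 = 0" "rform J n1 n2 = 0"
    "rform h r r = a + q1 + q2 - b1 - b2" "rform h n1 n1 = q1" "rform h n2 n2 = q2"
    "rform h r n1 = k1" "rform h r n2 = k2" "rform h n1 n2 = 0"
proof -
  note I = residue_identities[OF ne d0 d1 d2]
  have J': "rform J g1 f = 0" "rform J g2 f = 0" "rform J g2 g1 = 0"
    using J(4-6) by (simp_all only: rform_commute[of J g1 f] rform_commute[of J g2 f] rform_commute[of J g2 g1])
  have h': "rform h g1 f = 0" "rform h g2 f = 0" "rform h g2 g1 = 0"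
    using h(4-6) by (simp_all only: rform_commute[of h g1 f] rform_commute[of h g2 f] rform_commute[of h g2 g1])
  have Jc: "rform J (\<lambda>k. x * f k + y * g1 k + z * g2 k) (\<lambda>k. x' * f k + y' * g1 k + z' * g2 k) = x * x' - y * y' - z * z'"
    for x y z x' y' z'
    by (simp add: rform_lincomb3 J J')
  have hc: "rform h (\<lambda>k. x * f k + y * g1 k + z * g2 k) (\<lambda>k. x' * f k + y' * g1 k + z' * g2 k) = a * x * x' + b1 * y * y' + b2 * z * z'"
    for x y z x' y' z'
    by (simp add: rform_lincomb3 h h')
  show Jrr: "rform J r r = 1" unfolding r_def Jc using I(1) by (simp add: power2_eq_square)
  show "rform h r r = a + q1 + q2 - b1 - b2"
    unfolding r_def hc using I(7) by (simp add: power2_eq_square mult.assoc)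
  show Jr1: "rform J r n1 = 0"
  proof -
    have "rform J r n1 = k1 * (d0\<^sup>2 / (a + q1) - d1\<^sup>2 / (q1 - b1) - d2\<^sup>2 / (q1 - b2))"
      unfolding r_def n1_def Jc by (simp add: algebra_simps power2_eq_square)
    then show ?thesis using I(2) by simp
  qed
  show Jr2: "rform J r n2 = 0"
  proof -
    have "rform J r n2 = k2 * (d0\<^sup>2 / (a + q2) - d1\<^sup>2 / (q2 - b1) - d2\<^sup>2 / (q2 - b2))"
      unfolding r_def n2_def Jc by (simp add: algebra_simps power2_eq_square)
    then show ?thesis using I(3) by simp
  qed
  show Jn12: "rform J n1 n2 = 0"
  proof -
    have "rform J n1 n2 = k1 * k2 * (d0\<^sup>2 / (a + q1) / (a + q2) - d1\<^sup>2 / (q1 - b1) / (q2 - b1) - d2\<^sup>2 / (q1 - b2) / (q2 - b2))"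
      unfolding n1_def n2_def Jc by (simp add: algebra_simps power2_eq_square)
    then show ?thesis using I(4) by simp
  qed
  show Jn11: "rform J n1 n1 = - 1"
  proof -
    have "rform J n1 n1 = k1\<^sup>2 * (d0\<^sup>2 / (a + q1)\<^sup>2 - d1\<^sup>2 / (q1 - b1)\<^sup>2 - d2\<^sup>2 / (q1 - b2)\<^sup>2)"
      unfolding n1_def Jc by (simp add: algebra_simps power2_eq_square)
    then show ?thesis unfolding k1 using I(5) by simp
  qed
  show Jn22: "rform J n2 n2 = - 1"
  proof -
    have "rform J n2 n2 = k2\<^sup>2 * (d0\<^sup>2 / (a + q2)\<^sup>2 - d1\<^sup>2 / (q2 - b1)\<^sup>2 - d2\<^sup>2 / (q2 - b2)\<^sup>2)"
      unfolding n2_def Jc by (simp add: algebra_simps power2_eq_square)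
    then show ?thesis unfolding k2 using I(6) by simp
  qed
  \<comment> \<open>\<open>n\<^sub>i\<close> is a multiple of the resolvent \<open>(h + q\<^sub>i J)\<^sup>-\<^sup>1 J r\<close>.\<close>
  have resolvent1: "rform h v n1 = k1 * rform J v r - q1 * rform J v n1"
    if v: "v = (\<lambda>k. x * f k + y * g1 k + z * g2 k)" for v x y z
  proof -
    have e: "a * (d0 / (a + q1)) = d0 - q1 * (d0 / (a + q1))" "b1 * (d1 / (q1 - b1)) = q1 * (d1 / (q1 - b1)) - d1"
      "b2 * (d2 / (q1 - b2)) = q1 * (d2 / (q1 - b2)) - d2"
      using ne by (simp_all add: field_simps)
    have "rform h v n1 = x * k1 * (a * (d0 / (a + q1))) + y * k1 * (b1 * (d1 / (q1 - b1))) + z * k1 * (b2 * (d2 / (q1 - b2)))"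
      unfolding v n1_def hc by (simp add: mult_ac)
    also have "\<dots> = k1 * rform J v r - q1 * rform J v n1"
      unfolding e v r_def n1_def Jc by (simp add: algebra_simps)
    finally show ?thesis .
  qed
  have resolvent2: "rform h v n2 = k2 * rform J v r - q2 * rform J v n2"
    if v: "v = (\<lambda>k. x * f k + y * g1 k + z * g2 k)" for v x y z
  proof -
    have e: "a * (d0 / (a + q2)) = d0 - q2 * (d0 / (a + q2))" "b1 * (d1 / (q2 - b1)) = q2 * (d1 / (q2 - b1)) - d1"
      "b2 * (d2 / (q2 - b2)) = q2 * (d2 / (q2 - b2)) - d2"
      using ne by (simp_all add: field_simps)
    have "rform h v n2 = x * k2 * (a * (d0 / (a + q2))) + y * k2 * (b1 * (d1 / (q2 - b1))) + z * k2 * (b2 * (d2 / (q2 - b2)))"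
      unfolding v n2_def hc by (simp add: mult_ac)
    also have "\<dots> = k2 * rform J v r - q2 * rform J v n2"
      unfolding e v r_def n2_def Jc by (simp add: algebra_simps)
    finally show ?thesis .
  qed
  have Jsym: "rform J n1 r = 0" "rform J n2 r = 0"
    using Jr1 Jr2 by (simp_all only: rform_commute[of J n1 r] rform_commute[of J n2 r])
  show "rform h r n1 = k1" using resolvent1[OF r_def[THEN meta_eq_to_obj_eq]] by (simp add: Jrr Jr1)
  show "rform h r n2 = k2" using resolvent2[OF r_def[THEN meta_eq_to_obj_eq]] by (simp add: Jrr Jr2)
  show "rform h n1 n1 = q1" using resolvent1[OF n1_def[THEN meta_eq_to_obj_eq]] by (simp add: Jsym Jn11)
  show "rform h n2 n2 = q2" using resolvent2[OF n2_def[THEN meta_eq_to_obj_eq]] by (simp add: Jsym Jn22)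
  show "rform h n1 n2 = 0" using resolvent2[OF n1_def[THEN meta_eq_to_obj_eq]] by (simp add: Jsym Jn12)
qed

text \<open>Trace and discriminant determine the eigenvalues of a symmetric 2 by 2 matrix, so only
  these two numbers of the positive block must be controlled. The rotation uses half the polar angle
  of \<open>(A11 - A22, 2 * A12)\<close> divided by \<open>x1 - x2\<close>.\<close>

lemma rotation_diagonalizes:
  fixes A11 :: real
  assumes tr: "A11 + A22 = x1 + x2" and disc: "(A11 - A22)\<^sup>2 + 4 * A12\<^sup>2 = (x1 - x2)\<^sup>2"
  shows "\<exists>c s. c\<^sup>2 + s\<^sup>2 = 1 \<and> c\<^sup>2 * A11 + 2 * c * s * A12 + s\<^sup>2 * A22 = x1 \<and>
    s\<^sup>2 * A11 - 2 * c * s * A12 + c\<^sup>2 * A22 = x2 \<and> c * s * (A22 - A11) + (c\<^sup>2 - s\<^sup>2) * A12 = 0"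
proof (cases "x1 = x2")
  case True
  then have "A11 = A22" "A12 = 0"
    using disc by (simp_all add: add_nonneg_eq_0_iff)
  with tr True show ?thesis by (intro exI[of _ 1] exI[of _ 0]) auto
next
  case False
  define X where "X = x1 - x2"
  have X: "X \<noteq> 0" using False by (simp add: X_def)
  have "((A11 - A22) / X)\<^sup>2 + (2 * A12 / X)\<^sup>2 = 1"
    using disc X by (simp add: X_def power_divide power_mult_distrib flip: add_divide_distrib)
  then obtain t where t: "(A11 - A22) / X = cos t" "2 * A12 / X = sin t"
    using sincos_total_2pi by metis
  define c s where "c = cos (t / 2)" and "s = sin (t / 2)"
  have cs: "c\<^sup>2 + s\<^sup>2 = 1" by (simp add: c_def s_def)
  have "cos t = c\<^sup>2 - s\<^sup>2" "sin t = 2 * s * c"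
    using cos_double[of "t / 2"] sin_double[of "t / 2"] by (simp_all add: c_def s_def)
  with t X have d: "A11 - A22 = X * (c\<^sup>2 - s\<^sup>2)" "A12 = X * (s * c)"
    by (simp_all add: field_simps)
  have A: "A11 = x1 * c\<^sup>2 + x2 * s\<^sup>2" "A22 = x1 * s\<^sup>2 + x2 * c\<^sup>2" "A12 = (x1 - x2) * (s * c)"
    using d tr cs unfolding X_def by algebra+
  show ?thesis
    by (rule exI[of _ c], rule exI[of _ s], unfold A, intro conjI cs)
       (use cs in algebra, use cs in algebra, simp add: algebra_simps)
qed

text \<open>The left-hand side is the discriminant of the positive block as a function of the intermediate
  values. On the sides of the rectangle one or both of the square roots vanish.\<close>

lemma intermediate_pattern_exists:
  fixes a1 :: real
  assumes a: "a1 > a2" and b: "b1 > b2" and ab: "a2 + b2 > 0"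
    and u: "u1 > u2" "u1 > b1" "u2 > b2" "u2 \<noteq> b1"
    and x: "x1 > x2" "x1 > a1" "x2 > a2"
    and tr: "x1 + x2 - u1 - u2 = a1 + a2 - b1 - b2"
    and i1: "\<bar>(x1 - x2) - (u1 - u2)\<bar> < (a1 - a2) + (b1 - b2)"
    and i2: "(x1 - x2) + (u1 - u2) > \<bar>(a1 - a2) - (b1 - b2)\<bar>"
  shows "\<exists>q1 q2. b1 < q1 \<and> u2 < q1 \<and> q1 < u1 \<and> b2 < q2 \<and> q2 < b1 \<and> q2 < u2 \<and>
    (a1 - a2 + u1 + u2 + b1 + b2 - 2 * q1 - 2 * q2)\<^sup>2
      + 4 * (sqrt ((a2 + q1) * (q1 - b1) * (q1 - b2) / (q1 - q2)) * sqrt ((u1 - q1) * (q1 - u2) / ((a1 + q1) * (q1 - q2)))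
           - sqrt ((a2 + q2) * (b1 - q2) * (q2 - b2) / (q1 - q2)) * sqrt ((u1 - q2) * (u2 - q2) / ((a1 + q2) * (q1 - q2))))\<^sup>2
    = (x1 - x2)\<^sup>2"
proof -
  \<comment> \<open>Interlacing with both \<open>b1, b2\<close> and \<open>u1, u2\<close> confines
    \<open>q1\<close> to the interval from \<open>M\<close> to \<open>u1\<close> and
    \<open>q2\<close> to the one from \<open>b2\<close> to \<open>m\<close>.\<close>
  define M m where "M = max b1 u2" and "m = min b1 u2"
  define V where "V p = a1 - a2 + u1 + u2 + b1 + b2 - 2 * fst p - 2 * snd p" for p :: "real \<times> real"
  define K1 where "K1 p = sqrt ((a2 + fst p) * (fst p - b1) * (fst p - b2) / (fst p - snd p))
      * sqrt ((u1 - fst p) * (fst p - u2) / ((a1 + fst p) * (fst p - snd p)))" for p :: "real \<times> real"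
  define K2 where "K2 p = sqrt ((a2 + snd p) * (b1 - snd p) * (snd p - b2) / (fst p - snd p))
      * sqrt ((u1 - snd p) * (u2 - snd p) / ((a1 + snd p) * (fst p - snd p)))" for p :: "real \<times> real"
  define f where "f p = (V p)\<^sup>2 + 4 * (K1 p - K2 p)\<^sup>2" for p
  define S where "S = {M..u1} \<times> {b2..m}"
  define S' where "S' = {M<..<u1} \<times> {b2<..<m}"
  have Mm: "m < M" "M < u1" "b2 < m" using u b by (auto simp: M_def m_def)
  have ne: "fst p - snd p \<noteq> 0" "a1 + fst p \<noteq> 0" "a1 + snd p \<noteq> 0" if "p \<in> S" for p
    using that Mm a ab by (auto simp: S_def)
  have contK: "continuous_on S K1" "continuous_on S K2"
    unfolding K1_def K2_def using ne by (auto intro!: continuous_intros)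
  then have contf: "continuous_on S f"
    unfolding f_def V_def by (intro continuous_intros)
  have K1_nonneg: "K1 p \<ge> 0" and K2_nonneg: "K2 p \<ge> 0" if "p \<in> S" for p
    using that Mm a b ab u unfolding K1_def K2_def S_def M_def m_def
    by (auto intro!: mult_nonneg_nonneg divide_nonneg_nonneg)
  have K1_0: "K1 (q1, q2) = 0" if "q1 = M \<or> q1 = u1" for q1 q2
    using that by (auto simp: K1_def M_def max_def)
  have K2_0: "K2 (q1, q2) = 0" if "q2 = m \<or> q2 = b2" for q1 q2
    using that by (auto simp: K2_def m_def min_def)
  have corner: "f (q1, q2) = (V (q1, q2))\<^sup>2" if "q1 = M \<or> q1 = u1" "q2 = m \<or> q2 = b2" for q1 q2
    using that by (simp add: f_def K1_0 K2_0)

  \<comment> \<open>\<open>V\<close> decreases in both variables, so it is largest at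
    \<open>(M, b2)\<close>. It exceeds \<open>x1 - x2\<close> there by \<open>x2 > a2\<close> if
    \<open>M = b1\<close> and by \<open>i1\<close> if \<open>M = u2\<close>.\<close>
  have hi: "\<exists>p\<in>S. f p > (x1 - x2)\<^sup>2"
  proof (intro bexI)
    have "V (M, b2) > x1 - x2"
      using tr i1 x unfolding V_def M_def by (auto simp: max_def)
    then have "(V (M, b2))\<^sup>2 > (x1 - x2)\<^sup>2"
      using x by (intro power_strict_mono) auto
    then show "f (M, b2) > (x1 - x2)\<^sup>2" by (simp add: corner)
    show "(M, b2) \<in> S" using Mm by (simp add: S_def)
  qed
  have lo: "\<exists>p\<in>S. f p < (x1 - x2)\<^sup>2"
  proof -
    have sq: "f (q1, q2) < (x1 - x2)\<^sup>2"
      if "q1 = M \<or> q1 = u1" "q2 = m \<or> q2 = b2" "\<bar>V (q1, q2)\<bar> < x1 - x2" for q1 q2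
      using power_strict_mono[OF that(3), of 2] by (simp add: corner[OF that(1,2)])
    have mem: "(M, m) \<in> S" "(u1, b2) \<in> S" "(u1, m) \<in> S" using Mm by (auto simp: S_def)
    \<comment> \<open>In the first three cases a corner already has \<open>V\<close> of modulus
      below \<open>x1 - x2\<close>. In the last one, \<open>V\<close> vanishes along a segment that
      cuts off the corner \<open>(u1, m)\<close>.\<close>
    consider "V (u1, m) \<ge> 0" | "V (u1, b2) \<le> 0" | "V (M, m) \<le> 0"
      | "V (u1, m) < 0" "V (u1, b2) > 0" "V (M, m) > 0" by linarith
    then show ?thesis
    proof cases
      case 1
      then have "\<bar>V (u1, m)\<bar> < x1 - x2"
        using tr i2 x unfolding V_def m_def by (auto simp: min_def split: if_splits)
      then show ?thesis using mem sq by blast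
    next
      case 2
      then have "\<bar>V (u1, b2)\<bar> < x1 - x2"
        using tr i1 x unfolding V_def by auto
      then show ?thesis using mem sq by blast
    next
      case 3
      then have "\<bar>V (M, m)\<bar> < x1 - x2"
        using tr i2 x unfolding V_def M_def m_def by (auto simp: max_def min_def split: if_splits)
      then show ?thesis using mem sq by blast
    next
      case 4
      define P where "P = (u1 + V (u1, m) / 2, m)"
      define Q where "Q = (u1, m + V (u1, m) / 2)"
      have PQ: "P \<in> S" "Q \<in> S"
      proof -
        have "V (M, m) = V (u1, m) + 2 * (u1 - M)" "V (u1, b2) = V (u1, m) + 2 * (m - b2)"
          by (simp_all add: V_def)
        with 4 have "M \<le> u1 + V (u1, m) / 2" "b2 \<le> m + V (u1, m) / 2"
          by simp_all
        then show "P \<in> S" "Q \<in> S" using 4 Mm by (auto simp: P_def Q_def S_def)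
      qed
      have V0: "V p = 0" if seg: "p \<in> closed_segment P Q" for p
      proof -
        have "V P = 0" "V Q = 0" by (simp_all add: P_def Q_def V_def field_simps)
        moreover obtain t where p: "p = (1 - t) *\<^sub>R P + t *\<^sub>R Q"
          using seg by (auto simp: closed_segment_def)
        have "V p = (1 - t) * V P + t * V Q"
          unfolding p V_def by (simp add: algebra_simps)
        ultimately show ?thesis by simp
      qed
      have sub: "closed_segment P Q \<subseteq> S"
        using PQ by (rule closed_segment_subset) (simp add: S_def convex_Times convex_real_interval)
      \<comment> \<open>\<open>K2\<close> vanishes at \<open>P\<close> and \<open>K1\<close> at
        \<open>Q\<close>, so \<open>K1 - K2\<close> has a zero on the segment, and there
        \<open>f\<close> is zero.\<close>
      have "connected ((\<lambda>p. K1 p - K2 p) ` closed_segment P Q)"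
        by (intro connected_continuous_image continuous_on_diff connected_segment contK[THEN continuous_on_subset] sub)
      moreover have "K1 P - K2 P \<ge> 0" "K1 Q - K2 Q \<le> 0"
        using K1_nonneg[OF PQ(1)] K2_nonneg[OF PQ(2)] by (simp_all add: P_def Q_def K1_0 K2_0)
      ultimately have "0 \<in> (\<lambda>p. K1 p - K2 p) ` closed_segment P Q"
        by (intro connectedD_interval[OF _ imageI[of Q] imageI[of P]]) simp_all
      then obtain p where p: "p \<in> closed_segment P Q" "K1 p - K2 p = 0" by (rule imageE) simp
      then have "f p = 0" by (simp add: f_def V0)
      moreover have "p \<in> S" using p(1) sub by (rule subsetD[rotated])
      ultimately show ?thesis using x by (intro bexI[of _ p]) simp_all
    qed
  qed
  have cl: "closure S' = S"
    using Mm by (simp add: S_def S'_def closure_Times)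
  \<comment> \<open>By continuity, strict inequalities found on \<open>S\<close> also occur on the
    dense subset \<open>S'\<close>, where the interlacing is strict.\<close>
  have "\<exists>p\<in>S'. f p > (x1 - x2)\<^sup>2"
  proof (rule ccontr)
    assume "\<not> ?thesis"
    then have bound: "\<And>p. p \<in> S' \<Longrightarrow> f p \<le> (x1 - x2)\<^sup>2" by (simp add: not_less)
    have "f p \<le> (x1 - x2)\<^sup>2" if "p \<in> S" for p
      by (rule continuous_le_on_closure[of S' f]) (use that contf cl bound in simp_all)
    with hi show False by (meson leD)
  qed
  then obtain p where p: "p \<in> S'" "f p > (x1 - x2)\<^sup>2" by blast
  have "\<exists>p\<in>S'. f p < (x1 - x2)\<^sup>2"
  proof (rule ccontr)
    assume "\<not> ?thesis"
    then have bound: "\<And>p. p \<in> S' \<Longrightarrow> f p \<ge> (x1 - x2)\<^sup>2" by (simp add: not_less)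
    have "f p \<ge> (x1 - x2)\<^sup>2" if "p \<in> S" for p
      by (rule continuous_ge_on_closure[of S' f]) (use that contf cl bound in simp_all)
    with lo show False by (meson leD)
  qed
  then obtain p' where p': "p' \<in> S'" "f p' < (x1 - x2)\<^sup>2" by blast
  have "connected (f ` S')"
  proof (rule connected_continuous_image)
    show "continuous_on S' f"
      using contf closure_subset[of S'] unfolding cl by (rule continuous_on_subset)
    show "connected S'"
      unfolding S'_def by (intro connected_Times connected_Ioo)
  qed
  then have "(x1 - x2)\<^sup>2 \<in> f ` S'"
    by (rule connectedD_interval[OF _ imageI[OF p'(1)] imageI[OF p(1)] less_imp_le[OF p'(2)] less_imp_le[OF p(2)]])
  then obtain q where "q \<in> S'" "f q = (x1 - x2)\<^sup>2" by (rule imageE) simp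
  then have q: "b1 < fst q \<and> u2 < fst q \<and> fst q < u1 \<and> b2 < snd q \<and> snd q < b1 \<and> snd q < u2 \<and> f q = (x1 - x2)\<^sup>2"
    by (simp add: S'_def M_def m_def mem_Times_iff)
  show ?thesis
    by (rule exI[of _ "fst q"], rule exI[of _ "snd q"]) (fact q[unfolded f_def V_def K1_def K2_def])
qed

text \<open>The signs of \<open>d1\<close> and \<open>d2\<close> stay free because the second
  application takes one of them negative. That \<open>n1\<close> and \<open>n2\<close> lie in the
  span makes orthogonality to further vectors carry over.\<close>

lemma gelfand_tsetlin_exists:
  fixes a :: real
  assumes J: "rform J f f = 1" "rform J g1 g1 = - 1" "rform J g2 g2 = - 1"
      "rform J f g1 = 0" "rform J f g2 = 0" "rform J g1 g2 = 0"
    and h: "rform h f f = a" "rform h g1 g1 = b1" "rform h g2 g2 = b2"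
      "rform h f g1 = 0" "rform h f g2 = 0" "rform h g1 g2 = 0"
    and ord: "a + b2 > 0" "b2 < q2" "q2 < b1" "b1 < q1"
    and d1: "d1\<^sup>2 = (q1 - b1) * (b1 - q2) / ((a + b1) * (b1 - b2))"
    and d2: "d2\<^sup>2 = (q1 - b2) * (q2 - b2) / ((a + b2) * (b1 - b2))"
  obtains d0 r n1 n2 where "r = (\<lambda>k. d0 * f k + d1 * g1 k + d2 * g2 k)"
    "\<exists>x y z. n1 = (\<lambda>k. x * f k + y * g1 k + z * g2 k)"
    "\<exists>x y z. n2 = (\<lambda>k. x * f k + y * g1 k + z * g2 k)"
    "rform J r r = 1" "rform J n1 n1 = - 1" "rform J n2 n2 = - 1"
    "rform J r n1 = 0" "rform J r n2 = 0" "rform J n1 n2 = 0"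
    "rform h r r = a + q1 + q2 - b1 - b2" "rform h n1 n1 = q1" "rform h n2 n2 = q2"
    "rform h r n1 = sqrt ((a + q1) * (q1 - b1) * (q1 - b2) / (q1 - q2))"
    "rform h r n2 = sqrt ((a + q2) * (b1 - q2) * (q2 - b2) / (q1 - q2))" "rform h n1 n2 = 0"
proof -
  have ne: "a + b1 \<noteq> 0" "a + b2 \<noteq> 0" "b1 \<noteq> b2" "a + q1 \<noteq> 0" "a + q2 \<noteq> 0" "q1 \<noteq> q2"
     "q1 \<noteq> b1" "q1 \<noteq> b2" "q2 \<noteq> b1" "q2 \<noteq> b2"
    using ord by auto
  define d0 where "d0 = sqrt ((a + q1) * (a + q2) / ((a + b1) * (a + b2)))"
  define k1 where "k1 = sqrt ((a + q1) * (q1 - b1) * (q1 - b2) / (q1 - q2))"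
  define k2 where "k2 = sqrt ((a + q2) * (b1 - q2) * (q2 - b2) / (q1 - q2))"
  have d0: "d0\<^sup>2 = (a + q1) * (a + q2) / ((a + b1) * (a + b2))"
    and k1: "k1\<^sup>2 = (a + q1) * (q1 - b1) * (q1 - b2) / (q1 - q2)"
    and k2: "k2\<^sup>2 = (a + q2) * (b1 - q2) * (q2 - b2) / (q1 - q2)"
    unfolding d0_def k1_def k2_def using ord by auto
  note G = gelfand_tsetlin_step[OF J h ne d0 d1 d2 k1 k2]
  show thesis
    by (rule that[unfolded k1_def[symmetric] k2_def[symmetric], OF refl _ _ G]) (rule exI, rule exI, rule exI, rule refl)+
qed

text \<open>The moment condition for real matrices, with \<open>d\<close> and \<open>e\<close>
  standing for \<open>\<Lambda>\<close> and \<open>\<xi>\<close> multiplied by the signs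
  \<open>J22\<close>. The determinant is normalised afterwards, in
  \<open>realizable_SU22\<close>.\<close>

definition realizable :: "(4 \<Rightarrow> real) \<Rightarrow> (4 \<Rightarrow> real) \<Rightarrow> bool" where
  "realizable d e \<longleftrightarrow> (\<exists>g :: real ^ 4 ^ 4.
     (\<forall>i j. rform J22 (\<lambda>k. g $ i $ k) (\<lambda>k. g $ j $ k) = (if i = j then J22 i else 0)) \<and>
     (\<forall>i j. J22 i = J22 j \<longrightarrow> rform d (\<lambda>k. g $ i $ k) (\<lambda>k. g $ j $ k) = (if i = j then e i else 0)))"

text \<open>The first step replaces \<open>unit 2\<close>, \<open>unit 4\<close>,
  \<open>unit 3\<close> by \<open>r\<close>, \<open>n1\<close>, \<open>n2\<close>, the second
  \<open>unit 1\<close>, \<open>n1\<close>, \<open>n2\<close> by \<open>t\<close>,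
  \<open>m1\<close>, \<open>m2\<close>. Then \<open>m2\<close> and \<open>m1\<close> carry
  \<open>e 3\<close> and \<open>e 4\<close>, and a rotation in the plane of \<open>r\<close> and
  \<open>t\<close> diagonalizes the positive block.\<close>

lemma realizable_generic:
  assumes a: "d 1 > d 2" and b: "d 4 > d 3" and ab: "d 2 + d 3 > 0"
    and u: "e 4 > e 3" "e 4 > d 4" "e 3 > d 3" "e 3 \<noteq> d 4"
    and x: "e 1 > e 2" "e 1 > d 1" "e 2 > d 2"
    and tr: "e 1 + e 2 - e 4 - e 3 = d 1 + d 2 - d 4 - d 3"
    and i1: "\<bar>(e 1 - e 2) - (e 4 - e 3)\<bar> < (d 1 - d 2) + (d 4 - d 3)"
    and i2: "(e 1 - e 2) + (e 4 - e 3) > \<bar>(d 1 - d 2) - (d 4 - d 3)\<bar>"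
  shows "realizable d e"
proof -
  obtain q1 q2 where q: "d 4 < q1" "e 3 < q1" "q1 < e 4" "d 3 < q2" "q2 < d 4" "q2 < e 3"
    and eq: "(d 1 - d 2 + e 4 + e 3 + d 4 + d 3 - 2 * q1 - 2 * q2)\<^sup>2
      + 4 * (sqrt ((d 2 + q1) * (q1 - d 4) * (q1 - d 3) / (q1 - q2)) * sqrt ((e 4 - q1) * (q1 - e 3) / ((d 1 + q1) * (q1 - q2)))
           - sqrt ((d 2 + q2) * (d 4 - q2) * (q2 - d 3) / (q1 - q2)) * sqrt ((e 4 - q2) * (e 3 - q2) / ((d 1 + q2) * (q1 - q2))))\<^sup>2
    = (e 1 - e 2)\<^sup>2"
    using intermediate_pattern_exists[OF a b ab u x tr i1 i2] by blast
  define c1 where "c1 = sqrt ((e 4 - q1) * (q1 - e 3) / ((d 1 + q1) * (q1 - q2)))"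
  \<comment> \<open>The minus sign turns \<open>rform d r t = c1 * k1 + c2 * k2\<close> into the
    difference whose square occurs in \<open>eq\<close>.\<close>
  define c2 where "c2 = - sqrt ((e 4 - q2) * (e 3 - q2) / ((d 1 + q2) * (q1 - q2)))"
  define k1 where "k1 = sqrt ((d 2 + q1) * (q1 - d 4) * (q1 - d 3) / (q1 - q2))"
  define k2 where "k2 = sqrt ((d 2 + q2) * (d 4 - q2) * (q2 - d 3) / (q1 - q2))"
  define p1 where "p1 = sqrt ((q1 - d 4) * (d 4 - q2) / ((d 2 + d 4) * (d 4 - d 3)))"
  define p2 where "p2 = sqrt ((q1 - d 3) * (q2 - d 3) / ((d 2 + d 3) * (d 4 - d 3)))"
  define unit :: "4 \<Rightarrow> 4 \<Rightarrow> real" where "unit i k = (if k = i then 1 else 0)" for i k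
  have unit: "rform c (unit i) (unit j) = (if i = j then c i else 0)" for c i j
  proof -
    have "rform c (unit i) (unit j) = (\<Sum>k\<in>UNIV. if k = i then (if i = j then c i else 0) else 0)"
      unfolding rform_def by (intro sum.cong refl) (auto simp: unit_def)
    then show ?thesis by (simp add: sum.delta)
  qed
  have p: "p1\<^sup>2 = (q1 - d 4) * (d 4 - q2) / ((d 2 + d 4) * (d 4 - d 3))"
    "p2\<^sup>2 = (q1 - d 3) * (q2 - d 3) / ((d 2 + d 3) * (d 4 - d 3))"
    unfolding p1_def p2_def using q a b ab u by auto
  have c: "c1\<^sup>2 = (e 4 - q1) * (q1 - e 3) / ((d 1 + q1) * (q1 - q2))"
    "c2\<^sup>2 = (e 4 - q2) * (e 3 - q2) / ((d 1 + q2) * (q1 - q2))"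
    unfolding c1_def c2_def using q a b ab u by auto
  have U: "rform J22 (unit 2) (unit 2) = 1" "rform J22 (unit 4) (unit 4) = - 1" "rform J22 (unit 3) (unit 3) = - 1"
    "rform J22 (unit 2) (unit 4) = 0" "rform J22 (unit 2) (unit 3) = 0" "rform J22 (unit 4) (unit 3) = 0"
    "rform d (unit 2) (unit 2) = d 2" "rform d (unit 4) (unit 4) = d 4" "rform d (unit 3) (unit 3) = d 3"
    "rform d (unit 2) (unit 4) = 0" "rform d (unit 2) (unit 3) = 0" "rform d (unit 4) (unit 3) = 0"
    by (simp_all add: unit)
  obtain p0 r n1 n2 where r: "r = (\<lambda>k. p0 * unit 2 k + p1 * unit 4 k + p2 * unit 3 k)"
    and n1: "\<exists>x y z. n1 = (\<lambda>k. x * unit 2 k + y * unit 4 k + z * unit 3 k)"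
    and n2: "\<exists>x y z. n2 = (\<lambda>k. x * unit 2 k + y * unit 4 k + z * unit 3 k)"
    and Jr: "rform J22 r r = 1" "rform J22 n1 n1 = - 1" "rform J22 n2 n2 = - 1"
      "rform J22 r n1 = 0" "rform J22 r n2 = 0" "rform J22 n1 n2 = 0"
    and hr: "rform d r r = d 2 + q1 + q2 - d 4 - d 3" "rform d n1 n1 = q1" "rform d n2 n2 = q2"
      "rform d r n1 = k1" "rform d r n2 = k2" "rform d n1 n2 = 0"
    unfolding k1_def k2_def
    by (rule gelfand_tsetlin_exists[OF U ab q(4) q(5) q(1) p])
  have u1: "rform s (unit 1) r = 0" "rform s (unit 1) n1 = 0" "rform s (unit 1) n2 = 0" for s
    using n1 n2 by (auto simp: r rform_lincomb3 unit)
  have 1: "d 1 + q2 > 0" "e 3 < q1" using q a ab by auto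
  have U': "rform J22 (unit 1) (unit 1) = 1" "rform J22 n1 n1 = - 1" "rform J22 n2 n2 = - 1"
    "rform J22 (unit 1) n1 = 0" "rform J22 (unit 1) n2 = 0" "rform J22 n1 n2 = 0"
    "rform d (unit 1) (unit 1) = d 1" "rform d n1 n1 = q1" "rform d n2 n2 = q2"
    "rform d (unit 1) n1 = 0" "rform d (unit 1) n2 = 0" "rform d n1 n2 = 0"
    by (simp_all add: unit u1 Jr hr)
  obtain c0 t m1 m2 where t: "t = (\<lambda>k. c0 * unit 1 k + c1 * n1 k + c2 * n2 k)"
    and m1: "\<exists>x y z. m1 = (\<lambda>k. x * unit 1 k + y * n1 k + z * n2 k)"
    and m2: "\<exists>x y z. m2 = (\<lambda>k. x * unit 1 k + y * n1 k + z * n2 k)"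
    and Jt: "rform J22 t t = 1" "rform J22 m1 m1 = - 1" "rform J22 m2 m2 = - 1"
      "rform J22 t m1 = 0" "rform J22 t m2 = 0" "rform J22 m1 m2 = 0"
    and ht: "rform d t t = d 1 + e 4 + e 3 - q1 - q2" "rform d m1 m1 = e 4" "rform d m2 m2 = e 3"
      "rform d t m1 = sqrt ((d 1 + e 4) * (e 4 - q1) * (e 4 - q2) / (e 4 - e 3))"
      "rform d t m2 = sqrt ((d 1 + e 3) * (q1 - e 3) * (e 3 - q2) / (e 4 - e 3))" "rform d m1 m2 = 0"
    by (rule gelfand_tsetlin_exists[OF U' 1(1) q(6) 1(2) q(3) c])
  have ru1: "rform s r (unit 1) = 0" for s by (simp add: rform_commute[of s r "unit 1"] u1)
  have Jrt: "rform J22 r t = 0" and hrt: "rform d r t = c1 * k1 + c2 * k2"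
    by (simp_all add: t rform_lincomb3 ru1 Jr hr mult.commute)
  have Jrm: "rform J22 r m1 = 0" "rform J22 r m2 = 0"
    using m1 m2 by (auto simp: rform_lincomb3 ru1 Jr)
  have tr': "rform d r r + rform d t t = e 1 + e 2"
    using tr by (simp add: hr ht)
  have disc: "(rform d r r - rform d t t)\<^sup>2 + 4 * (rform d r t)\<^sup>2 = (e 1 - e 2)\<^sup>2"
  proof -
    have "(d 2 + q1 + q2 - d 4 - d 3 - (d 1 + e 4 + e 3 - q1 - q2))\<^sup>2 = (d 1 - d 2 + e 4 + e 3 + d 4 + d 3 - 2 * q1 - 2 * q2)\<^sup>2"
      by (simp add: power2_eq_iff)
    moreover have "(c1 * k1 + c2 * k2)\<^sup>2 = (k1 * c1 - k2 * (- c2))\<^sup>2" by (simp add: mult.commute)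
    ultimately show ?thesis using eq unfolding hr ht hrt k1_def k2_def c1_def c2_def by simp
  qed
  obtain c s where cs: "c\<^sup>2 + s\<^sup>2 = 1"
    and rot: "c\<^sup>2 * rform d r r + 2 * c * s * rform d r t + s\<^sup>2 * rform d t t = e 1"
    "s\<^sup>2 * rform d r r - 2 * c * s * rform d r t + c\<^sup>2 * rform d t t = e 2"
    "c * s * (rform d t t - rform d r r) + (c\<^sup>2 - s\<^sup>2) * rform d r t = 0"
    using rotation_diagonalizes[OF tr' disc] by blast
  define s' where "s' = - s"
  define v where "v i = (if i = 1 then (\<lambda>k. c * r k + s * t k) else if i = 2 then (\<lambda>k. s' * r k + c * t k)
     else if i = 3 then m2 else m1)" for i :: 4
  have sym: "rform w t r = rform w r t" "rform w m1 r = rform w r m1" "rform w m2 r = rform w r m2"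
    "rform w m1 t = rform w t m1" "rform w m2 t = rform w t m2" "rform w m2 m1 = rform w m1 m2" for w
    by (rule rform_commute)+
  have "rform J22 (v i) (v j) = (if i = j then J22 i else 0)" for i j
  proof -
    have "\<forall>i j. rform J22 (v i) (v j) = (if i = j then J22 i else 0)"
      unfolding forall_4
      by (simp add: v_def rform_lincomb2 sym Jr Jt Jrt Jrm) (use cs in \<open>simp add: s'_def power2_eq_square\<close>)
    then show ?thesis by blast
  qed
  moreover have "rform d (v i) (v j) = (if i = j then e i else 0)" if "J22 i = J22 j" for i j
  proof -
    have "\<forall>i j. J22 i = J22 j \<longrightarrow> rform d (v i) (v j) = (if i = j then e i else 0)"
      unfolding forall_4
      by (simp add: v_def rform_lincomb2 sym ht(2,3,6)) (use rot in \<open>simp add: s'_def power2_eq_square algebra_simps\<close>)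
    then show ?thesis using that by blast
  qed
  ultimately show ?thesis
    unfolding realizable_def by (intro exI[of _ "\<chi> i k. v i k"]) (simp add: vec_lambda_inverse)
qed

section \<open>From generic parameters to the closed polyhedron\<close>

text \<open>With \<open>c\<close> midway between \<open>- d 3\<close> and \<open>d 2\<close>, the
  form \<open>h - c J\<close> is positive definite. Its values on the rows are prescribed, so the
  approximating matrices are eventually bounded and a subsequence converges.\<close>

lemma realizable_limit:
  assumes R: "\<And>n. realizable (D n) (E n)"
    and D: "\<And>k. (\<lambda>n. D n k) \<longlonglongrightarrow> d k" and E: "\<And>k. (\<lambda>n. E n k) \<longlonglongrightarrow> e k"
    and d: "d 1 \<ge> d 2" "d 4 \<ge> d 3" "d 2 + d 3 > 0"
  shows "realizable d e"
proof -
  obtain G :: "nat \<Rightarrow> real ^ 4 ^ 4" where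
    GJ: "\<And>n i j. rform J22 (\<lambda>k. G n $ i $ k) (\<lambda>k. G n $ j $ k) = (if i = j then J22 i else 0)" and
    GD: "\<And>n i j. J22 i = J22 j \<Longrightarrow> rform (D n) (\<lambda>k. G n $ i $ k) (\<lambda>k. G n $ j $ k) = (if i = j then E n i else 0)"
    using R unfolding realizable_def by metis
  define c \<delta> where "c = (d 2 - d 3) / 2" and "\<delta> = (d 2 + d 3) / 2"
  have \<delta>: "\<delta> > 0" using d by (simp add: \<delta>_def)
  have gap: "\<delta> \<le> d k - c * J22 k" for k
    using exhaust_4[of k] d by (auto simp: c_def \<delta>_def field_simps)
  have "\<forall>\<^sub>F n in sequentially. \<forall>k\<in>UNIV. \<delta> / 2 < D n k - c * J22 k"
  proof (rule eventually_ball_finite, simp, intro ballI)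
    fix k
    have "(\<lambda>n. D n k - c * J22 k) \<longlonglongrightarrow> d k - c * J22 k" by (intro tendsto_intros D)
    moreover have "\<delta> / 2 < d k - c * J22 k" using gap[of k] \<delta> by linarith
    ultimately show "\<forall>\<^sub>F n in sequentially. \<delta> / 2 < D n k - c * J22 k" by (rule order_tendstoD)
  qed
  moreover have "\<forall>\<^sub>F n in sequentially. \<forall>k\<in>UNIV. E n k < e k + 1"
    by (rule eventually_ball_finite, simp, intro ballI order_tendstoD(2)[OF E]) simp
  ultimately have "\<forall>\<^sub>F n in sequentially. \<forall>k. \<delta> / 2 < D n k - c * J22 k \<and> E n k < e k + 1"
    by eventually_elim auto
  then obtain N where N: "\<And>n k. n \<ge> N \<Longrightarrow> \<delta> / 2 < D n k - c * J22 k \<and> E n k < e k + 1"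
    unfolding eventually_sequentially by blast
  define b where "b i = (e i + 1 - c * J22 i) / (\<delta> / 2)" for i
  have ent: "\<bar>G n $ i $ k\<bar> \<le> b i + 1" if n: "n \<ge> N" for n i k
  proof -
    have "\<delta> / 2 * (G n $ i $ k)\<^sup>2 \<le> (\<Sum>k\<in>UNIV. \<delta> / 2 * (G n $ i $ k)\<^sup>2)"
      using \<delta> by (intro member_le_sum) auto
    also have "\<dots> \<le> (\<Sum>k\<in>UNIV. (D n k - c * J22 k) * (G n $ i $ k)\<^sup>2)"
      using N[OF n] by (intro sum_mono mult_right_mono) (auto intro: less_imp_le)
    also have "\<dots> = rform (D n) (\<lambda>k. G n $ i $ k) (\<lambda>k. G n $ i $ k) - c * rform J22 (\<lambda>k. G n $ i $ k) (\<lambda>k. G n $ i $ k)"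
      by (simp add: rform_def sum_distrib_left power2_eq_square algebra_simps flip: sum_subtractf)
    also have "\<dots> \<le> e i + 1 - c * J22 i"
      using N[OF n, of i] by (simp add: GJ GD)
    finally have "(G n $ i $ k)\<^sup>2 \<le> b i"
      using \<delta> unfolding b_def by (simp add: pos_le_divide_eq mult.commute)
    moreover have "2 * \<bar>G n $ i $ k\<bar> \<le> (G n $ i $ k)\<^sup>2 + 1"
      using zero_le_power2[of "\<bar>G n $ i $ k\<bar> - 1"] by (simp add: power2_eq_square algebra_simps)
    moreover have "0 \<le> (G n $ i $ k)\<^sup>2" by simp
    ultimately show ?thesis by linarith
  qed
  have "bounded (range (\<lambda>n. G (n + N)))"
  proof (rule boundedI)
    fix x assume "x \<in> range (\<lambda>n. G (n + N))"
    then obtain n where x: "x = G (n + N)" by auto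
    have "norm x \<le> (\<Sum>i\<in>UNIV. norm (x $ i))"
      unfolding norm_vec_def by (rule L2_set_le_sum) simp
    also have "\<dots> \<le> (\<Sum>i\<in>UNIV. \<Sum>k\<in>UNIV. \<bar>x $ i $ k\<bar>)"
      by (intro sum_mono norm_le_l1_cart)
    also have "\<dots> \<le> (\<Sum>i\<in>(UNIV :: 4 set). \<Sum>k\<in>(UNIV :: 4 set). b i + 1)"
      unfolding x by (intro sum_mono ent) simp
    finally show "norm x \<le> (\<Sum>i\<in>(UNIV :: 4 set). \<Sum>k\<in>(UNIV :: 4 set). b i + 1)" .
  qed
  then obtain l r where r: "strict_mono (r :: nat \<Rightarrow> nat)" and l: "((\<lambda>n. G (n + N)) \<circ> r) \<longlonglongrightarrow> l"
    using bounded_imp_convergent_subsequence by blast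
  define s where "s n = r n + N" for n
  have s: "strict_mono s" using r by (simp add: s_def strict_mono_def)
  have Gl: "(\<lambda>n. G (s n) $ i $ k) \<longlonglongrightarrow> l $ i $ k" for i k
    using l unfolding o_def s_def by (intro tendsto_vec_nth)
  have Ds: "(\<lambda>n. D (s n) k) \<longlonglongrightarrow> d k" and Es: "(\<lambda>n. E (s n) k) \<longlonglongrightarrow> e k" for k
    using LIMSEQ_subseq_LIMSEQ[OF D s] LIMSEQ_subseq_LIMSEQ[OF E s] by (simp_all add: o_def)
  have "rform J22 (\<lambda>k. l $ i $ k) (\<lambda>k. l $ j $ k) = (if i = j then J22 i else 0)" for i j
  proof (rule LIMSEQ_unique)
    show "(\<lambda>n. rform J22 (\<lambda>k. G (s n) $ i $ k) (\<lambda>k. G (s n) $ j $ k)) \<longlonglongrightarrow> rform J22 (\<lambda>k. l $ i $ k) (\<lambda>k. l $ j $ k)"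
      unfolding rform_def by (intro tendsto_intros Gl)
    show "(\<lambda>n. rform J22 (\<lambda>k. G (s n) $ i $ k) (\<lambda>k. G (s n) $ j $ k)) \<longlonglongrightarrow> (if i = j then J22 i else 0)"
      by (simp add: GJ)
  qed
  moreover have "rform d (\<lambda>k. l $ i $ k) (\<lambda>k. l $ j $ k) = (if i = j then e i else 0)" if "J22 i = J22 j" for i j
  proof (rule LIMSEQ_unique)
    show "(\<lambda>n. rform (D (s n)) (\<lambda>k. G (s n) $ i $ k) (\<lambda>k. G (s n) $ j $ k)) \<longlonglongrightarrow> rform d (\<lambda>k. l $ i $ k) (\<lambda>k. l $ j $ k)"
      unfolding rform_def by (intro tendsto_intros Gl Ds)
    show "(\<lambda>n. rform (D (s n)) (\<lambda>k. G (s n) $ i $ k) (\<lambda>k. G (s n) $ j $ k)) \<longlonglongrightarrow> (if i = j then e i else 0)"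
      using Es by (simp add: GD that)
  qed
  ultimately show ?thesis unfolding realizable_def by blast
qed

text \<open>The constraints are convex, so a proper mixture with a point satisfying them strictly
  satisfies them strictly. The hypothesis \<open>side\<close> keeps it off the wall
  \<open>e 3 = d 4\<close>, which the generic case excludes.\<close>

lemma realizable_mix:
  fixes t :: real
  assumes t: "0 < t" "t < 1"
    and nonstrict: "d 1 \<ge> d 2" "d 4 \<ge> d 3" "d 2 + d 3 > 0" "e 4 \<ge> e 3" "e 4 \<ge> d 4" "e 3 \<ge> d 3"
      "e 1 \<ge> e 2" "e 1 \<ge> d 1" "e 2 \<ge> d 2"
      "e 1 + e 2 - e 4 - e 3 = d 1 + d 2 - d 4 - d 3"
      "\<bar>(e 1 - e 2) - (e 4 - e 3)\<bar> \<le> (d 1 - d 2) + (d 4 - d 3)"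
      "(e 1 - e 2) + (e 4 - e 3) \<ge> \<bar>(d 1 - d 2) - (d 4 - d 3)\<bar>"
    and strict: "d' 1 > d' 2" "d' 4 > d' 3" "d' 2 + d' 3 > 0" "e' 4 > e' 3" "e' 4 > d' 4" "e' 3 > d' 3"
      "e' 1 > e' 2" "e' 1 > d' 1" "e' 2 > d' 2"
      "e' 1 + e' 2 - e' 4 - e' 3 = d' 1 + d' 2 - d' 4 - d' 3"
      "\<bar>(e' 1 - e' 2) - (e' 4 - e' 3)\<bar> < (d' 1 - d' 2) + (d' 4 - d' 3)"
      "(e' 1 - e' 2) + (e' 4 - e' 3) > \<bar>(d' 1 - d' 2) - (d' 4 - d' 3)\<bar>"
    and side: "e 3 \<ge> d 4 \<and> e' 3 > d' 4 \<or> e 3 \<le> d 4 \<and> e' 3 < d' 4"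
  shows "realizable (\<lambda>k. (1 - t) * d k + t * d' k) (\<lambda>k. (1 - t) * e k + t * e' k)"
proof -
  have mix: "(1 - t) * p + t * q > 0" if "p \<ge> 0" "q > 0" for p q
    using that t by (intro add_nonneg_pos mult_nonneg_nonneg mult_pos_pos) auto
  show ?thesis
  proof (rule realizable_generic)
    show "(1 - t) * d 2 + t * d' 2 < (1 - t) * d 1 + t * d' 1"
      using mix[of "d 1 - d 2" "d' 1 - d' 2"] nonstrict strict by (simp add: algebra_simps)
    show "(1 - t) * d 3 + t * d' 3 < (1 - t) * d 4 + t * d' 4"
      using mix[of "d 4 - d 3" "d' 4 - d' 3"] nonstrict strict by (simp add: algebra_simps)
    show "0 < (1 - t) * d 2 + t * d' 2 + ((1 - t) * d 3 + t * d' 3)"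
      using mix[of "d 2 + d 3" "d' 2 + d' 3"] nonstrict strict by (simp add: algebra_simps)
    show "(1 - t) * e 3 + t * e' 3 < (1 - t) * e 4 + t * e' 4"
      using mix[of "e 4 - e 3" "e' 4 - e' 3"] nonstrict strict by (simp add: algebra_simps)
    show "(1 - t) * d 4 + t * d' 4 < (1 - t) * e 4 + t * e' 4"
      using mix[of "e 4 - d 4" "e' 4 - d' 4"] nonstrict strict by (simp add: algebra_simps)
    show "(1 - t) * d 3 + t * d' 3 < (1 - t) * e 3 + t * e' 3"
      using mix[of "e 3 - d 3" "e' 3 - d' 3"] nonstrict strict by (simp add: algebra_simps)
    show "(1 - t) * e 2 + t * e' 2 < (1 - t) * e 1 + t * e' 1"
      using mix[of "e 1 - e 2" "e' 1 - e' 2"] nonstrict strict by (simp add: algebra_simps)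
    show "(1 - t) * d 1 + t * d' 1 < (1 - t) * e 1 + t * e' 1"
      using mix[of "e 1 - d 1" "e' 1 - d' 1"] nonstrict strict by (simp add: algebra_simps)
    show "(1 - t) * d 2 + t * d' 2 < (1 - t) * e 2 + t * e' 2"
      using mix[of "e 2 - d 2" "e' 2 - d' 2"] nonstrict strict by (simp add: algebra_simps)
    show "(1 - t) * e 3 + t * e' 3 \<noteq> (1 - t) * d 4 + t * d' 4"
      using side mix[of "e 3 - d 4" "e' 3 - d' 4"] mix[of "d 4 - e 3" "d' 4 - e' 3"] by (auto simp: algebra_simps)
    have comb: "(1 - t) * p1 + t * q1 + ((1 - t) * p2 + t * q2) - ((1 - t) * p4 + t * q4) - ((1 - t) * p3 + t * q3)
       = (1 - t) * (p1 + p2 - p4 - p3) + t * (q1 + q2 - q4 - q3)" for p1 p2 p3 p4 q1 q2 q3 q4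
      by (simp add: algebra_simps)
    show "(1 - t) * e 1 + t * e' 1 + ((1 - t) * e 2 + t * e' 2) - ((1 - t) * e 4 + t * e' 4) - ((1 - t) * e 3 + t * e' 3)
       = (1 - t) * d 1 + t * d' 1 + ((1 - t) * d 2 + t * d' 2) - ((1 - t) * d 4 + t * d' 4) - ((1 - t) * d 3 + t * d' 3)"
      unfolding comb nonstrict(10) strict(10) ..
    have abs_mix: "\<bar>(1 - t) * p + t * q\<bar> < (1 - t) * p' + t * q'" if "\<bar>p\<bar> \<le> p'" "\<bar>q\<bar> < q'" for p q p' q'
      using mix[of "p' - p" "q' - q"] mix[of "p' + p" "q' + q"] that by (simp add: abs_le_iff abs_less_iff algebra_simps)
    have comb2: "(1 - t) * p1 + t * q1 - ((1 - t) * p2 + t * q2) - ((1 - t) * p4 + t * q4 - ((1 - t) * p3 + t * q3))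
       = (1 - t) * ((p1 - p2) - (p4 - p3)) + t * ((q1 - q2) - (q4 - q3))"
       "(1 - t) * p1 + t * q1 - ((1 - t) * p2 + t * q2) + ((1 - t) * p4 + t * q4 - ((1 - t) * p3 + t * q3))
       = (1 - t) * ((p1 - p2) + (p4 - p3)) + t * ((q1 - q2) + (q4 - q3))" for p1 p2 p3 p4 q1 q2 q3 q4
      by (simp_all add: algebra_simps)
    show "\<bar>(1 - t) * e 1 + t * e' 1 - ((1 - t) * e 2 + t * e' 2) - ((1 - t) * e 4 + t * e' 4 - ((1 - t) * e 3 + t * e' 3))\<bar>
        < (1 - t) * d 1 + t * d' 1 - ((1 - t) * d 2 + t * d' 2) + ((1 - t) * d 4 + t * d' 4 - ((1 - t) * d 3 + t * d' 3))"
      unfolding comb2 by (rule abs_mix[OF nonstrict(11) strict(11)])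
    show "\<bar>(1 - t) * d 1 + t * d' 1 - ((1 - t) * d 2 + t * d' 2) - ((1 - t) * d 4 + t * d' 4 - ((1 - t) * d 3 + t * d' 3))\<bar>
        < (1 - t) * e 1 + t * e' 1 - ((1 - t) * e 2 + t * e' 2) + ((1 - t) * e 4 + t * e' 4 - ((1 - t) * e 3 + t * e' 3))"
      unfolding comb2 by (rule abs_mix[OF nonstrict(12) strict(12)])
  qed
qed

lemma realizable_polyhedron:
  assumes le: "d 1 \<ge> d 2" "d 4 \<ge> d 3" "d 2 + d 3 > 0" "e 4 \<ge> e 3" "e 4 \<ge> d 4" "e 3 \<ge> d 3"
      "e 1 \<ge> e 2" "e 1 \<ge> d 1" "e 2 \<ge> d 2"
      "e 1 + e 2 - e 4 - e 3 = d 1 + d 2 - d 4 - d 3"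
      "\<bar>(e 1 - e 2) - (e 4 - e 3)\<bar> \<le> (d 1 - d 2) + (d 4 - d 3)"
      "(e 1 - e 2) + (e 4 - e 3) \<ge> \<bar>(d 1 - d 2) - (d 4 - d 3)\<bar>"
  shows "realizable d e"
proof -
  \<comment> \<open>Two interior points of the cone of all \<open>(d, e)\<close>, one on each side of the wall \<open>e 3 = d 4\<close>.\<close>
  define vec :: "real \<Rightarrow> real \<Rightarrow> real \<Rightarrow> real \<Rightarrow> 4 \<Rightarrow> real"
    where "vec x y z w k = (if k = 1 then x else if k = 2 then y else if k = 3 then z else w)" for x y z w k
  have vec: "vec x y z w 1 = x" "vec x y z w 2 = y" "vec x y z w 3 = z" "vec x y z w 4 = w" for x y z w
    by (simp_all add: vec_def)
  have "\<exists>d' e'. \<forall>t. 0 < t \<and> t < 1 \<longrightarrow> realizable (\<lambda>k. (1 - t) * d k + t * d' k) (\<lambda>k. (1 - t) * e k + t * e' k)"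
  proof (cases "e 3 \<ge> d 4")
    case True
    show ?thesis
      by (rule exI[of _ "vec 2 1 1 2"], rule exI[of _ "vec 5 4 4 5"], intro allI impI, rule realizable_mix[OF _ _ le])
         (use True in \<open>simp_all add: vec\<close>)
  next
    case False
    show ?thesis
      by (rule exI[of _ "vec 4 2 2 10"], rule exI[of _ "vec 13 7 6 20"], intro allI impI, rule realizable_mix[OF _ _ le])
         (use False in \<open>simp_all add: vec\<close>)
  qed
  then obtain d' e' where R: "\<And>t. 0 < t \<Longrightarrow> t < 1 \<Longrightarrow>
      realizable (\<lambda>k. (1 - t) * d k + t * d' k) (\<lambda>k. (1 - t) * e k + t * e' k)"
    by blast
  \<comment> \<open>The shift by 2 keeps \<open>t 0\<close> below 1 as well.\<close>
  define t where "t n = 1 / real (n + 2)" for n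
  have t0: "t \<longlonglongrightarrow> 0"
    unfolding t_def by (rule LIMSEQ_ignore_initial_segment[OF lim_1_over_n])
  have conv: "(\<lambda>n. (1 - t n) * p + t n * q) \<longlonglongrightarrow> p" for p q
  proof -
    have "(\<lambda>n. (1 - t n) * p + t n * q) \<longlonglongrightarrow> (1 - 0) * p + 0 * q"
      by (intro tendsto_intros t0)
    then show ?thesis by simp
  qed
  show ?thesis
  proof (rule realizable_limit[OF R])
    show "0 < t n" "t n < 1" for n by (simp_all add: t_def)
  qed (use conv le in simp_all)
qed

section \<open>From real matrices to \<open>SU22\<close>, and the theorem\<close>

lemma rform_scale: "rform c (\<lambda>k. x * v k) (\<lambda>k. y * w k) = x * y * rform c v w"
  by (simp add: rform_def sum_distrib_left mult_ac)

text \<open>Row orthonormality gives \<open>det g\<close> square 1; multiplying the first row by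
  \<open>det g\<close> makes the determinant 1 and preserves both sets of relations.\<close>

lemma realizable_SU22:
  assumes "realizable (\<lambda>k. \<Lambda> $ k * J22 k) (\<lambda>k. \<xi> $ k * J22 k)"
  shows "\<exists>g\<in>SU22. \<forall>i j. J22 i = J22 j \<longrightarrow> herm_form \<Lambda> g i j = (if i = j then of_real (\<xi> $ i * J22 i) else 0)"
proof -
  obtain g :: "real ^ 4 ^ 4" where
    gJ: "\<And>i j. rform J22 (\<lambda>k. g $ i $ k) (\<lambda>k. g $ j $ k) = (if i = j then J22 i else 0)" and
    gh: "\<And>i j. J22 i = J22 j \<Longrightarrow> rform (\<lambda>k. \<Lambda> $ k * J22 k) (\<lambda>k. g $ i $ k) (\<lambda>k. g $ j $ k) = (if i = j then \<xi> $ i * J22 i else 0)"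
    using assms unfolding realizable_def by blast
  define J :: "real ^ 4 ^ 4" where "J = (\<chi> i j. if i = j then J22 i else 0)"
  have "g ** J ** transpose g = J"
  proof -
    have "(g ** J ** transpose g) $ i $ j = rform J22 (\<lambda>k. g $ i $ k) (\<lambda>k. g $ j $ k)" for i j
      by (simp add: matrix_matrix_mult_def J_def transpose_def rform_def if_distrib sum.delta mult.commute[of "g $ i $ _"]
          cong: if_cong)
    then show ?thesis by (simp add: vec_eq_iff gJ J_def)
  qed
  then have "det g * det J * det g = det J"
    by (metis det_mul det_transpose)
  moreover have "det J \<noteq> 0"
    by (subst det_diagonal) (auto simp: J_def J22_def)
  ultimately have det: "det g * det g = 1" by (simp add: mult_ac)
  define \<sigma> where "\<sigma> i = (if i = 1 then det g else 1)" for i :: 4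
  have \<sigma>: "\<sigma> i * \<sigma> i = 1" for i by (simp add: \<sigma>_def det)
  define r :: "real ^ 4 ^ 4" where "r = (\<chi> i. if i = 1 then det g *s g $ i else g $ i)"
  have r: "r $ i $ k = \<sigma> i * g $ i $ k" for i k by (simp add: r_def \<sigma>_def)
  have "det r = det g * det (\<chi> i. if i = 1 then g $ i else g $ i)"
    unfolding r_def by (rule det_row_mul)
  then have det_r: "det r = 1" by (simp add: det)
  have rJ: "rform J22 (\<lambda>k. r $ i $ k) (\<lambda>k. r $ j $ k) = (if i = j then J22 i else 0)" for i j
    unfolding r rform_scale gJ by (simp add: \<sigma>)
  have rh: "rform (\<lambda>k. \<Lambda> $ k * J22 k) (\<lambda>k. r $ i $ k) (\<lambda>k. r $ j $ k) = (if i = j then \<xi> $ i * J22 i else 0)"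
    if "J22 i = J22 j" for i j
    unfolding r rform_scale gh[OF that] by (simp add: \<sigma>)
  define h :: mat4 where "h = (\<chi> i k. of_real (r $ i $ k))"
  have "h ** (I22 ** conj_transpose h ** I22) = mat 1"
  proof -
    have "(h ** (I22 ** conj_transpose h ** I22)) $ i $ j = of_real (J22 j * rform J22 (\<lambda>k. r $ i $ k) (\<lambda>k. r $ j $ k))" for i j
      by (simp only: matrix_mult_nth[of h] mult_I22_nth I22_mult_nth)
         (simp add: conj_transpose_def h_def rform_def sum_distrib_left mult_ac)
    then show ?thesis by (simp add: vec_eq_iff rJ mat_def)
  qed
  \<comment> \<open>Passing from a right to a left inverse turns the row relations into the column
    relations that define \<open>SU22\<close>.\<close>
  then have inv: "(I22 ** conj_transpose h ** I22) ** h = mat 1" by (simp add: matrix_left_right_inverse)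
  have JJ: "I22 ** I22 = mat 1"
    by (simp add: vec_eq_iff mult_I22_nth I22_nth mat_def)
  have "conj_transpose h ** I22 ** h = (I22 ** I22) ** (conj_transpose h ** I22 ** h)"
    by (simp add: JJ)
  also have "\<dots> = I22 ** ((I22 ** conj_transpose h ** I22) ** h)"
    by (simp add: matrix_mul_assoc)
  finally have "conj_transpose h ** I22 ** h = I22" by (simp add: inv)
  moreover have "det h = of_real (det r)"
    by (simp add: det_def h_def)
  ultimately have "h \<in> SU22" by (simp add: SU22_def det_r)
  moreover have "herm_form \<Lambda> h i j = of_real (rform (\<lambda>k. \<Lambda> $ k * J22 k) (\<lambda>k. r $ i $ k) (\<lambda>k. r $ j $ k))" for i j
    by (simp add: herm_form_def rform_def h_def)
  ultimately show ?thesis using rh by (intro bexI[of _ h]) auto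
qed

theorem mainTheorem12:
  fixes \<Lambda> :: "real ^ 4"
  assumes "\<Lambda> \<in> weight_lattice_rat \<inter> C_hol"
  shows "moment_polyhedron (coadjoint_orbit \<Lambda>) =
    {\<xi> \<in> t_dual.
       \<xi> $ 1 \<ge> \<Lambda> $ 1 \<and> \<xi> $ 2 \<ge> \<Lambda> $ 2 \<and> \<Lambda> $ 3 \<ge> \<xi> $ 3 \<and> \<Lambda> $ 4 \<ge> \<xi> $ 4 \<and>
       \<bar>\<xi> $ 1 - \<xi> $ 2 - \<xi> $ 3 + \<xi> $ 4\<bar> \<le> \<Lambda> $ 1 - \<Lambda> $ 2 + \<Lambda> $ 3 - \<Lambda> $ 4 \<and>
       - \<xi> $ 1 + \<xi> $ 2 - \<xi> $ 3 + \<xi> $ 4 \<le> - \<bar>\<Lambda> $ 1 - \<Lambda> $ 2 - \<Lambda> $ 3 + \<Lambda> $ 4\<bar> \<and>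
       \<xi> $ 1 \<ge> \<xi> $ 2 \<and> \<xi> $ 3 \<ge> \<xi> $ 4}"
    (is "_ = ?P")
proof (rule set_eqI)
  fix \<xi> :: "real ^ 4"
  have "\<Lambda> \<in> C_hol" using assms by blast
  then have \<Lambda>: "\<Lambda> \<in> t_dual" "\<Lambda> $ 1 \<ge> \<Lambda> $ 2" "\<Lambda> $ 2 > \<Lambda> $ 3" "\<Lambda> $ 3 \<ge> \<Lambda> $ 4"
    by (simp_all add: mem_C_hol_iff)
  have s\<Lambda>: "\<Lambda> $ 1 + \<Lambda> $ 2 + \<Lambda> $ 3 + \<Lambda> $ 4 = 0" using \<Lambda>(1) by (simp add: t_dual_def sum_4)
  show "\<xi> \<in> moment_polyhedron (coadjoint_orbit \<Lambda>) \<longleftrightarrow> \<xi> \<in> ?P"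
  proof
    assume "\<xi> \<in> moment_polyhedron (coadjoint_orbit \<Lambda>)"
    then obtain g where \<xi>: "\<xi> \<in> t_plus" and g: "g \<in> SU22"
      and hg: "\<And>i j. J22 i = J22 j \<Longrightarrow> herm_form \<Lambda> g i j = (if i = j then of_real (\<xi> $ i * J22 i) else 0)"
      unfolding mem_moment_polyhedron_iff[OF \<Lambda>(1)] by blast
    have x: "\<xi> $ 1 \<ge> \<xi> $ 2" "\<xi> $ 3 \<ge> \<xi> $ 4" "\<xi> $ 1 + \<xi> $ 2 + \<xi> $ 3 + \<xi> $ 4 = 0"
      using \<xi> by (simp_all add: t_plus_def t_dual_def sum_4)
    have J: "qform J22 (\<lambda>k. g $ i $ k) (\<lambda>k. g $ j $ k) = (if i = j then of_real (J22 i) else 0)" for i j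
      unfolding qform_def by (rule SU22_row_orthonormal[OF g])
    have h: "qform (\<lambda>k. \<Lambda> $ k * J22 k) (\<lambda>k. g $ i $ k) (\<lambda>k. g $ j $ k) = (if i = j then of_real (\<xi> $ i * J22 i) else 0)"
      if "J22 i = J22 j" for i j
      using hg[OF that] by (simp add: qform_def herm_form_def)
    note N = necessary_inequalities[of "\<lambda>i k. g $ i $ k" "\<lambda>k. \<Lambda> $ k * J22 k" "\<lambda>k. \<xi> $ k * J22 k", OF J h]
    \<comment> \<open>Reversing the order of the basis exchanges the roles of \<open>J\<close> and \<open>- J\<close>.\<close>
    define \<pi> :: "4 \<Rightarrow> 4" where "\<pi> i = (if i = 1 then 4 else if i = 2 then 3 else if i = 3 then 2 else 1)" for i
    have \<pi>: "\<pi> 1 = 4" "\<pi> 2 = 3" "\<pi> 3 = 2" "\<pi> 4 = 1" by (simp_all add: \<pi>_def)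
    have \<pi>J: "J22 (\<pi> i) = - J22 i" and \<pi>\<pi>: "\<pi> (\<pi> i) = i" for i
      using exhaust_4[of i] by (auto simp: \<pi>)
    have bij: "bij \<pi>" by (rule involuntory_imp_bij) (rule \<pi>\<pi>)
    have q\<pi>: "qform c (\<lambda>k. v (\<pi> k)) (\<lambda>k. w (\<pi> k)) = qform (\<lambda>k. c (\<pi> k)) v w" for c v w
      unfolding qform_def using sum.reindex_bij_betw[OF bij, of "\<lambda>k. of_real (c (\<pi> k)) * v k * cnj (w k)"]
      by (simp add: \<pi>\<pi>)
    have qneg: "qform (\<lambda>k. - c k) v w = - qform c v w" for c v w
      by (simp add: qform_def sum_negf)
    \<comment> \<open>Both the form and the prescribed value \<open>J22 (\<pi> i)\<close> change
      sign, so the relations keep their shape.\<close>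
    have J': "qform J22 (\<lambda>k. g $ \<pi> i $ \<pi> k) (\<lambda>k. g $ \<pi> j $ \<pi> k) = (if i = j then of_real (J22 i) else 0)" for i j
      using J[of "\<pi> i" "\<pi> j"] \<pi>\<pi> by (auto simp: q\<pi>[of _ "\<lambda>k. g $ \<pi> i $ k" "\<lambda>k. g $ \<pi> j $ k"] \<pi>J qneg dest: arg_cong[of _ _ \<pi>])
    have h': "qform (\<lambda>k. \<Lambda> $ \<pi> k * J22 (\<pi> k)) (\<lambda>k. g $ \<pi> i $ \<pi> k) (\<lambda>k. g $ \<pi> j $ \<pi> k)
        = (if i = j then of_real (\<xi> $ \<pi> i * J22 (\<pi> i)) else 0)" if "J22 i = J22 j" for i j
      using h[of "\<pi> i" "\<pi> j"] that \<pi>\<pi>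
      by (auto simp: q\<pi>[of _ "\<lambda>k. g $ \<pi> i $ k" "\<lambda>k. g $ \<pi> j $ k"] \<pi>J \<pi>\<pi> qneg dest: arg_cong[of _ _ \<pi>])
    note N' = necessary_inequalities[of "\<lambda>i k. g $ \<pi> i $ \<pi> k" "\<lambda>k. \<Lambda> $ \<pi> k * J22 (\<pi> k)" "\<lambda>k. \<xi> $ \<pi> k * J22 (\<pi> k)", OF J' h']
    have "\<Lambda> $ 1 \<le> \<xi> $ 1" "\<Lambda> $ 2 \<le> \<xi> $ 2" "\<Lambda> $ 2 + \<Lambda> $ 4 \<le> \<xi> $ 2 + \<xi> $ 3" "\<Lambda> $ 1 + \<Lambda> $ 4 \<le> \<xi> $ 1 + \<xi> $ 3"
      using N \<Lambda> x by simp_all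
    moreover have "\<xi> $ 4 \<le> \<Lambda> $ 4" "\<xi> $ 3 \<le> \<Lambda> $ 3" "\<xi> $ 3 + \<xi> $ 2 \<le> \<Lambda> $ 3 + \<Lambda> $ 1" "\<xi> $ 4 + \<xi> $ 2 \<le> \<Lambda> $ 4 + \<Lambda> $ 1"
      using N' \<Lambda> x by (simp_all add: \<pi>)
    \<comment> \<open>Since the coordinates sum to zero, each alternating sum in the two
      absolute-value conditions is, up to sign, twice a sum of two coordinates; the conditions thus
      split into the four inequalities between such sums.\<close>
    ultimately show "\<xi> \<in> ?P"
      using \<xi> x s\<Lambda> by (auto simp: t_plus_def abs_le_iff)
  next
    assume "\<xi> \<in> ?P"
    then have P: "\<xi> \<in> t_dual" "\<xi> $ 1 \<ge> \<Lambda> $ 1" "\<xi> $ 2 \<ge> \<Lambda> $ 2" "\<Lambda> $ 3 \<ge> \<xi> $ 3" "\<Lambda> $ 4 \<ge> \<xi> $ 4"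
       "\<bar>\<xi> $ 1 - \<xi> $ 2 - \<xi> $ 3 + \<xi> $ 4\<bar> \<le> \<Lambda> $ 1 - \<Lambda> $ 2 + \<Lambda> $ 3 - \<Lambda> $ 4"
       "- \<xi> $ 1 + \<xi> $ 2 - \<xi> $ 3 + \<xi> $ 4 \<le> - \<bar>\<Lambda> $ 1 - \<Lambda> $ 2 - \<Lambda> $ 3 + \<Lambda> $ 4\<bar>"
       "\<xi> $ 1 \<ge> \<xi> $ 2" "\<xi> $ 3 \<ge> \<xi> $ 4" by auto
    have s\<xi>: "\<xi> $ 1 + \<xi> $ 2 + \<xi> $ 3 + \<xi> $ 4 = 0" using P(1) by (simp add: t_dual_def sum_4)
    have P7: "\<bar>\<Lambda> $ 1 - \<Lambda> $ 2 - \<Lambda> $ 3 + \<Lambda> $ 4\<bar> \<le> \<xi> $ 1 - \<xi> $ 2 + \<xi> $ 3 - \<xi> $ 4"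
      using P(7) by linarith
    have "realizable (\<lambda>k. \<Lambda> $ k * J22 k) (\<lambda>k. \<xi> $ k * J22 k)"
      by (rule realizable_polyhedron) (use \<Lambda> P P7 s\<Lambda> s\<xi> in \<open>simp_all add: abs_le_iff\<close>)
    then show "\<xi> \<in> moment_polyhedron (coadjoint_orbit \<Lambda>)"
      unfolding mem_moment_polyhedron_iff[OF \<Lambda>(1)] using P realizable_SU22 by (simp add: t_plus_def)
  qed
qed

end
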